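(* Consider the linear-model selection setting with selected model $\hat k_n$, fixed constant $d\ge 0$ and sequence $\lambda_n\ge(\log n)^{-1}$ described in the context. Assume a nonparametric scenario (at each sample size $n$ the true model is not in the list $\Gamma$, and it may change with $n$) and that $\sigma^2$ is known. Assume there exist two sequences of integers $1\le a_n<b_n<n$ with $a_n\to\infty$ such that the following hold: (N1) $P(a_n\le r_{\hat k_n}\le b_n)\to1$ and $\sup_{a_n\le j\le b_n}\frac{B_{j,n}}{n-j}\to0$ as $n\to\infty$; (N2) there exist a positive sequence $\zeta_n\to0$ and a constant $c_0>0$ such that for $a_n\le j\le b_n$, $$N_j\cdot L_j\le c_0e^{\zeta_nB_{j,n}},\qquad N_j\le c_0e^{B_{j,n}^2/(10(n-j))},$$ and $$\limsup_{n\to\infty}\sum_{j=a_n}^{b_n}e^{-B_{j,n}^2/(10(n-j))}=0;$$ (N3) $$\limsup_{n\to\infty}\left[\sup_{\{k:\,a_n\le r_k\le b_n\}}\frac{\inf_{k^{(s)}\in S_1(k)}\|P_{k^{(s)},k}f_n\|^2}{(\lambda_n\log(n)-1)r_k+\|(I_n-M_k)f_n\|^2/\sigma^2+d\,n^{1/2}\log(n)}\right]=0 .$$ Then the parametricness index (for known $\sigma$) satisfies $\mathrm{PI}_n\stackrel{p}{\longrightarrow}1$ as $n\to\infty$.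
   Context: Regression model: $Y_i=f(x_i)+\varepsilon_i$, $i=1,\dots,n$, with fixed design points $x_i\in\mathbb R^p$, regression function $f$, and errors $\varepsilon_i$ independent $N(0,\sigma^2)$, $\sigma^2>0$. Write $\mathbf Y_n=(Y_1,\dots,Y_n)^T$, $f_n=(f(x_1),\dots,f(x_n))^T$, $I_n$ for the identity matrix and $\|\cdot\|$ for the Euclidean norm on $\mathbb R^n$. The true regression function may change with $n$. Candidate models: $\Gamma$ is the collection of indices $k$ of candidate models (it may change with $n$). Each model $k$ is a family of regression functions linear in a finite-dimensional parameter; $M_k$ is the orthogonal projection matrix onto the column space of its design matrix, $r_k=\mathrm{rank}(M_k)$, and $\hat{\mathbf Y}_k=M_k\mathbf Y_n$ is the least squares fit. For a model $k$, $S_1(k)$ is the set of all sub-models $k'$ of $k$ in $\Gamma$ (so the column space of $k'$ is contained in that of $k$) with $r_{k'}=r_k-1$. It is assumed throughout that $S_1(k)$ is nonempty for every $k\in\Gamma$ with $r_k>1$. For $k^{(s)}\in S_1(k)$, $P_{k^{(s)},k}=M_k-M_{k^{(s)}}$. Counts: $N_j$ is the number of models $k\in\Gamma$ with $r_k=j$; for $1<j<n$, $L_j=\max_{k\in\Gamma}\{\mathrm{card}(S_1(k)):r_k=j\}$. For $j<n$, $$B_{j,n}=\inf_{k\in\Gamma}\{(\lambda_n\log(n)-1)j+\|(I_n-M_k)f_n\|^2/\sigma^2+d\,n^{1/2}\log(n):r_k=j\}.$$ Information criterion (known $\sigma$): for $\lambda_n\ge(\log n)^{-1}$ and a constant $d\ge0$,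 $$IC_{\lambda_n,d}(k)=\|\mathbf Y_n-\hat{\mathbf Y}_k\|^2+\lambda_n\log(n)r_k\sigma^2-n\sigma^2+d\,n^{1/2}\log(n)\sigma^2 .$$ Parametricness index (known $\sigma$): let $\hat k_n\in\Gamma$ be the model selected (from the data) at sample size $n$ by a given potentially consistent model selection method (one that would select the true model with probability tending to 1 if the true model were among the candidates). Then $$\mathrm{PI}_n=\inf_{k\in S_1(\hat k_n)}\frac{IC_{\lambda_n,d}(k)}{IC_{\lambda_n,d}(\hat k_n)}\ \text{ if } r_{\hat k_n}>1,\qquad \mathrm{PI}_n=n\ \text{ if } r_{\hat k_n}=1 .$$ *)

theory Defs
  imports "HOL-Probability.Probability" "Jordan_Normal_Form.DL_Rank"
begin

text \<open>
  A regression function has type \<open>real ^ 'p \<Rightarrow> real\<close>.  A candidate model is given by the finite list of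
  its basis functions; the indices of a candidate list have type \<open>'k\<close>, and \<open>cand n\<close> is the set of
  candidates at sample size \<open>n\<close>.  Observations are numbered from 0, so the sample of size \<open>n\<close> consists of
  the observations \<open>i < n\<close>.
\<close>

record ('k, 'p) candidates =
  design :: "nat \<Rightarrow> real ^ 'p"
  basis_funs :: "'k \<Rightarrow> (real ^ 'p \<Rightarrow> real) list"
  cand :: "nat \<Rightarrow> 'k set"

definition family :: "('k, 'p::finite) candidates \<Rightarrow> 'k \<Rightarrow> (real ^ 'p \<Rightarrow> real) set" where
  "family S k =
     (let bs = basis_funs S k
      in {g. \<exists>\<theta> :: nat \<Rightarrow> real. \<forall>z. g z = (\<Sum>j<length bs. \<theta> j * (bs ! j) z)})"

definition sq_length :: "real vec \<Rightarrow> real" where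
  "sq_length v = scalar_prod v v"

definition signal :: "('k, 'p::finite) candidates \<Rightarrow> (real ^ 'p \<Rightarrow> real) \<Rightarrow> nat \<Rightarrow> real vec" where
  "signal S g n = vec n (\<lambda>i. g (design S i))"

definition observations ::
    "('k, 'p::finite) candidates \<Rightarrow> (nat \<Rightarrow> 'w \<Rightarrow> real) \<Rightarrow> (real ^ 'p \<Rightarrow> real) \<Rightarrow> nat \<Rightarrow> 'w \<Rightarrow> real vec" where
  "observations S \<epsilon> g n \<omega> = vec n (\<lambda>i. g (design S i) + \<epsilon> i \<omega>)"

definition design_matrix :: "('k, 'p::finite) candidates \<Rightarrow> nat \<Rightarrow> 'k \<Rightarrow> real mat" where
  "design_matrix S n k =
     mat n (length (basis_funs S k)) (\<lambda>(i, j). (basis_funs S k ! j) (design S i))"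

definition is_orthogonal_projection :: "nat \<Rightarrow> real mat \<Rightarrow> real vec set \<Rightarrow> bool" where
  "is_orthogonal_projection n P V \<longleftrightarrow>
     P \<in> carrier_mat n n \<and>
     (\<forall>v \<in> carrier_vec n. P *\<^sub>v v \<in> V \<and> (\<forall>w \<in> V. scalar_prod (v - P *\<^sub>v v) w = 0))"

text \<open>The matrix of the orthogonal projection onto a subspace of \<open>carrier_vec n\<close> exists and is unique.\<close>

definition proj_mat :: "('k, 'p::finite) candidates \<Rightarrow> nat \<Rightarrow> 'k \<Rightarrow> real mat" where
  "proj_mat S n k =
     (THE P. is_orthogonal_projection n P (vec_space.col_space n (design_matrix S n k)))"

definition model_rank :: "('k, 'p::finite) candidates \<Rightarrow> nat \<Rightarrow> 'k \<Rightarrow> nat" where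
  "model_rank S n k = vec_space.rank n (proj_mat S n k)"

definition S1 :: "('k, 'p::finite) candidates \<Rightarrow> nat \<Rightarrow> 'k \<Rightarrow> 'k set" where
  "S1 S n k = {k' \<in> cand S n. family S k' \<subseteq> family S k \<and> model_rank S n k' + 1 = model_rank S n k}"

text \<open>
  Counts, infima and suprema are extended real numbers, so that an infinite collection has cardinality
  \<open>\<infinity>\<close> and an infimum over no models is \<open>\<infinity>\<close>.
\<close>

definition ecard :: "'a set \<Rightarrow> ereal" where
  "ecard A = (if finite A then ereal (real (card A)) else \<infinity>)"

definition exp_ereal :: "ereal \<Rightarrow> ereal" where
  "exp_ereal x = (case x of ereal r \<Rightarrow> ereal (exp r) | PInfty \<Rightarrow> \<infinity> | MInfty \<Rightarrow> 0)"

definition models_of_rank :: "('k, 'p::finite) candidates \<Rightarrow> nat \<Rightarrow> nat \<Rightarrow> 'k set" where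
  "models_of_rank S n j = {k \<in> cand S n. model_rank S n k = j}"

definition num_models :: "('k, 'p::finite) candidates \<Rightarrow> nat \<Rightarrow> nat \<Rightarrow> ereal" where
  "num_models S n j = ecard (models_of_rank S n j)"

definition max_submodels :: "('k, 'p::finite) candidates \<Rightarrow> nat \<Rightarrow> nat \<Rightarrow> ereal" where
  "max_submodels S n j = (SUP k \<in> models_of_rank S n j. ecard (S1 S n k))"

text \<open>Below, \<open>f\<close> and \<open>l\<close> are the regression function and the penalty factor at sample size \<open>n\<close>.\<close>

definition complexity ::
    "('k, 'p::finite) candidates \<Rightarrow> (real ^ 'p \<Rightarrow> real) \<Rightarrow> real \<Rightarrow> real \<Rightarrow> real \<Rightarrow> nat \<Rightarrow> 'k \<Rightarrow> real" where
  "complexity S f \<sigma> l d n k =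
     (l * ln (real n) - 1) * real (model_rank S n k)
     + sq_length ((1\<^sub>m n - proj_mat S n k) *\<^sub>v signal S f n) / \<sigma>\<^sup>2
     + d * sqrt (real n) * ln (real n)"

definition B ::
    "('k, 'p::finite) candidates \<Rightarrow> (real ^ 'p \<Rightarrow> real) \<Rightarrow> real \<Rightarrow> real \<Rightarrow> real \<Rightarrow> nat \<Rightarrow> nat \<Rightarrow> ereal" where
  "B S f \<sigma> l d n j = (INF k \<in> models_of_rank S n j. ereal (complexity S f \<sigma> l d n k))"

definition IC ::
    "('k, 'p::finite) candidates \<Rightarrow> real \<Rightarrow> real \<Rightarrow> real \<Rightarrow> nat \<Rightarrow> real vec \<Rightarrow> 'k \<Rightarrow> real" where
  "IC S \<sigma> l d n y k =
     sq_length (y - proj_mat S n k *\<^sub>v y)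
     + l * ln (real n) * real (model_rank S n k) * \<sigma>\<^sup>2
     - real n * \<sigma>\<^sup>2
     + d * sqrt (real n) * ln (real n) * \<sigma>\<^sup>2"

text \<open>The index at the data \<open>y\<close>, when the model \<open>k\<close> has been selected.  A selected model of rank 0
  is treated like one of rank 1.\<close>

definition PI ::
    "('k, 'p::finite) candidates \<Rightarrow> real \<Rightarrow> real \<Rightarrow> real \<Rightarrow> nat \<Rightarrow> real vec \<Rightarrow> 'k \<Rightarrow> real" where
  "PI S \<sigma> l d n y k =
     (if model_rank S n k > 1
      then (INF k' \<in> S1 S n k. IC S \<sigma> l d n y k' / IC S \<sigma> l d n y k)
      else real n)"

text \<open>A selection method assigns an index to each data vector.\<close>

definition selection_method ::
    "('k, 'p::finite) candidates \<Rightarrow> (nat \<Rightarrow> real vec \<Rightarrow> 'k) \<Rightarrow> bool" where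
  "selection_method S sel \<longleftrightarrow>
     (\<forall>n\<ge>1. (\<lambda>y. sel n (vec n y)) \<in> Pi\<^sub>M {..<n} (\<lambda>_. borel) \<rightarrow>\<^sub>M count_space (cand S n))"

text \<open>The true model is the smallest candidate that contains the regression function.\<close>

definition is_true_model ::
    "('k, 'p::finite) candidates \<Rightarrow> (real ^ 'p \<Rightarrow> real) \<Rightarrow> nat \<Rightarrow> 'k \<Rightarrow> bool" where
  "is_true_model S g n k \<longleftrightarrow>
     k \<in> cand S n \<and> g \<in> family S k \<and>
     (\<forall>k' \<in> cand S n. g \<in> family S k' \<longrightarrow> family S k \<subseteq> family S k')"

text \<open>Consistency is required pointwise, for a fixed regression function with a fixed true model.  Models are
  compared through their families, since several indices may describe the same model.\<close>

definition potentially_consistent ::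
    "'w measure \<Rightarrow> (nat \<Rightarrow> 'w \<Rightarrow> real) \<Rightarrow> ('k, 'p::finite) candidates \<Rightarrow> (nat \<Rightarrow> real vec \<Rightarrow> 'k) \<Rightarrow> bool" where
  "potentially_consistent M \<epsilon> S sel \<longleftrightarrow>
     (\<forall>g k. (\<forall>\<^sub>F n in sequentially. is_true_model S g n k) \<longrightarrow>
        (\<lambda>n. measure M {\<omega> \<in> space M. family S (sel n (observations S \<epsilon> g n \<omega>)) = family S k})
          \<longlonglongrightarrow> 1)"

definition tendsto_in_probability :: "'w measure \<Rightarrow> (nat \<Rightarrow> 'w \<Rightarrow> real) \<Rightarrow> real \<Rightarrow> bool" where
  "tendsto_in_probability M X c \<longleftrightarrow>
     (\<forall>e>0. (\<lambda>n. measure M {\<omega> \<in> space M. \<bar>X n \<omega> - c\<bar> > e}) \<longlonglongrightarrow> 0)"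

end

theory Submission
  imports Defs
begin

text \<open>
  Let \<open>e\<close> be the vector of errors, \<open>Q = I - M\<^sub>k\<close>, \<open>P = M\<^sub>k - M\<^sub>k'\<close> for \<open>k' \<in> S\<^sub>1(k)\<close>, and let \<open>c\<^sub>k\<close> be the quantity
  minimised in \<open>B\<^sub>j\<^sub>,\<^sub>n\<close>.  Then \<open>IC(k) = \<sigma>\<^sup>2 c\<^sub>k + (\<parallel>Q e\<parallel>\<^sup>2 - \<sigma>\<^sup>2 (n - r\<^sub>k)) + 2 \<langle>Q f, e\<rangle>\<close> and
  \<open>IC(k') - IC(k) = \<parallel>P Y\<parallel>\<^sup>2 - \<lambda> log(n) \<sigma>\<^sup>2\<close>.  By the lower tail bound
  \<open>exp (- t\<^sup>2 / (4 m))\<close> for a chi-square variable with \<open>m\<close> degrees of freedom, applied with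
  \<open>t = 0.9 B\<^sub>j\<^sub>,\<^sub>n\<close>, and the Gaussian tail bounds for \<open>\<langle>Q f, e\<rangle>\<close> and for the rank-one quantity
  \<open>\<parallel>P e\<parallel>\<^sup>2\<close>, condition (N2) and a union bound give, outside an event of small probability,
  \<open>IC(k) \<ge> \<sigma>\<^sup>2 c\<^sub>k / 20\<close> and \<open>\<parallel>P e\<parallel>\<^sup>2 \<le> \<delta> \<sigma>\<^sup>2 c\<^sub>k\<close> simultaneously for all \<open>k\<close> with \<open>a\<^sub>n \<le> r\<^sub>k \<le> b\<^sub>n\<close>.
  The sum condition in (N2) together with (N1) forces \<open>B\<^sub>j\<^sub>,\<^sub>n \<rightarrow> \<infinity>\<close> uniformly, so that
  \<open>\<lambda> log(n) \<le> 1 + c\<^sub>k / r\<^sub>k\<close> is negligible against \<open>c\<^sub>k\<close>; by (N3) so is \<open>\<parallel>P f\<parallel>\<^sup>2\<close> for a suitable \<open>k'\<close>.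
\<close>

text \<open>The symbol is left to \<open>scalar_prod\<close>; with both notations active it would be
  ambiguous.\<close>

no_notation inner (infix "\<bullet>" 70)

section \<open>Gaussian errors\<close>

text \<open>Only the law of the errors is fixed. Candidates, regression function and penalty stay
  arguments of the lemmas, since they may vary with the sample size.\<close>

locale gaussian_noise = prob_space M for M :: "'w measure" +
  fixes \<epsilon> :: "nat \<Rightarrow> 'w \<Rightarrow> real" and \<sigma> :: real
  assumes sigma: "\<sigma> > 0"
    and indep: "indep_vars (\<lambda>_. borel) \<epsilon> UNIV"
    and normal: "\<And>i. distributed M lborel (\<epsilon> i) (normal_density 0 \<sigma>)"
begin

section \<open>Transforms of linear forms in the errors\<close>

lemma measurable_noise [measurable]: "\<epsilon> i \<in> borel_measurable M"
  using indep by (auto simp: indep_vars_def)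

lemma char_noise: "char (distr M borel (\<epsilon> i)) t = of_real (exp (- (\<sigma>\<^sup>2 * t\<^sup>2 / 2)))"
proof -
  have "distributed M lborel (\<lambda>\<omega>. 1 / \<sigma> * \<epsilon> i \<omega>) (normal_density (0 * (1 / \<sigma>)) (\<bar>1 / \<sigma>\<bar> * \<sigma>))"
    using normal_density_affine[OF normal, of "1 / \<sigma>" 0 i] sigma by simp
  then have D: "distributed M lborel (\<lambda>\<omega>. \<epsilon> i \<omega> / \<sigma>) std_normal_density"
    using sigma by simp
  have "char (distr M borel (\<epsilon> i)) t = (CLINT \<omega>|M. iexp (t * \<epsilon> i \<omega>))"
    by (simp add: char_def integral_distr)
  also have "\<dots> = (CLINT \<omega>|M. iexp ((\<sigma> * t) * (\<epsilon> i \<omega> / \<sigma>)))"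
    using sigma by (intro Bochner_Integration.integral_cong refl) simp
  also have "\<dots> = char (distr M lborel (\<lambda>\<omega>. \<epsilon> i \<omega> / \<sigma>)) (\<sigma> * t)"
    unfolding char_def by (rule integral_distr[symmetric]) auto
  also have "\<dots> = of_real (exp (- (\<sigma> * t)\<^sup>2 / 2))"
    unfolding distributed_distr_eq_density[OF D] char_std_normal_distribution by simp
  finally show ?thesis by (simp add: power_mult_distrib)
qed

text \<open>Independence turns the transform of the sum into a product. This is the case
  \<open>m = 0\<close> of \<open>laplace_char_noise\<close>.\<close>

lemma char_noise_sum:
  fixes w :: "nat \<Rightarrow> real"
  shows "(CLINT \<omega>|M. iexp (\<Sum>i<n. w i * \<epsilon> i \<omega>)) = of_real (exp (- (\<sigma>\<^sup>2 / 2 * (\<Sum>i<n. (w i)\<^sup>2))))"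
proof -
  have "indep_vars (\<lambda>_. borel) (\<lambda>i \<omega>. w i * \<epsilon> i \<omega>) {..<n}"
    by (rule indep_vars_compose2[OF indep_vars_subset[OF indep]]) auto
  from char_distr_sum[OF this, of 1]
  have "(CLINT \<omega>|M. iexp (\<Sum>i<n. w i * \<epsilon> i \<omega>)) = (\<Prod>i<n. char (distr M borel (\<lambda>\<omega>. w i * \<epsilon> i \<omega>)) 1)"
    by (simp add: char_def integral_distr)
  also have "\<dots> = (\<Prod>i<n. char (distr M borel (\<epsilon> i)) (w i))"
    by (simp add: char_def integral_distr)
  also have "\<dots> = of_real (exp (\<Sum>i<n. - (\<sigma>\<^sup>2 * (w i)\<^sup>2 / 2)))"
    unfolding char_noise by (simp add: exp_sum)
  finally show ?thesis by (simp add: sum_negf sum_distrib_left)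
qed

text \<open>Completing the square: weighting the density by \<open>exp (t * x)\<close> moves its
  mean from 0 to \<open>t * \<sigma>\<^sup>2\<close>. Integrals in \<open>ennreal\<close> avoid
  integrability conditions.\<close>

lemma mgf_noise: "(\<integral>\<^sup>+\<omega>. ennreal (exp (t * \<epsilon> i \<omega>)) \<partial>M) = ennreal (exp (\<sigma>\<^sup>2 / 2 * t\<^sup>2))"
proof -
  have *: "normal_density 0 \<sigma> x * exp (t * x) = exp (\<sigma>\<^sup>2 / 2 * t\<^sup>2) * normal_density (t * \<sigma>\<^sup>2) \<sigma> x" for x
  proof -
    have "- x\<^sup>2 / (2 * \<sigma>\<^sup>2) + t * x = \<sigma>\<^sup>2 / 2 * t\<^sup>2 - (x - t * \<sigma>\<^sup>2)\<^sup>2 / (2 * \<sigma>\<^sup>2)"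
      using sigma by (simp add: divide_simps) (simp add: power2_eq_square algebra_simps)
    then have "exp (- x\<^sup>2 / (2 * \<sigma>\<^sup>2)) * exp (t * x) = exp (\<sigma>\<^sup>2 / 2 * t\<^sup>2) * exp (- ((x - t * \<sigma>\<^sup>2)\<^sup>2 / (2 * \<sigma>\<^sup>2)))"
      by (simp only: exp_add[symmetric] diff_conv_add_uminus)
    then show ?thesis
      by (simp add: normal_density_def)
  qed
  have "(\<integral>\<^sup>+\<omega>. ennreal (exp (t * \<epsilon> i \<omega>)) \<partial>M)
      = (\<integral>\<^sup>+x. ennreal (normal_density 0 \<sigma> x) * ennreal (exp (t * x)) \<partial>lborel)"
    by (rule distributed_nn_integral[OF normal, symmetric]) simp
  also have "\<dots> = (\<integral>\<^sup>+x. ennreal (exp (\<sigma>\<^sup>2 / 2 * t\<^sup>2)) * ennreal (normal_density (t * \<sigma>\<^sup>2) \<sigma> x) \<partial>lborel)"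
    by (simp only: ennreal_mult[symmetric] normal_density_nonneg exp_ge_zero *)
  also have "\<dots> = ennreal (exp (\<sigma>\<^sup>2 / 2 * t\<^sup>2)) * (\<integral>\<^sup>+x. ennreal (normal_density (t * \<sigma>\<^sup>2) \<sigma> x) \<partial>lborel)"
    by (rule nn_integral_cmult) simp
  also have "(\<integral>\<^sup>+x. ennreal (normal_density (t * \<sigma>\<^sup>2) \<sigma> x) \<partial>lborel) = 1"
    using sigma by (subst nn_integral_eq_integral) (auto simp: integral_normal_density)
  finally show ?thesis by simp
qed

lemma mgf_noise_sum:
  fixes w :: "nat \<Rightarrow> real"
  shows "(\<integral>\<^sup>+\<omega>. ennreal (exp (\<Sum>i<n. w i * \<epsilon> i \<omega>)) \<partial>M) = ennreal (exp (\<sigma>\<^sup>2 / 2 * (\<Sum>i<n. (w i)\<^sup>2)))"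
proof -
  have I: "indep_vars (\<lambda>_. borel) (\<lambda>i \<omega>. ennreal (exp (w i * \<epsilon> i \<omega>))) {..<n}"
    by (rule indep_vars_compose2[OF indep_vars_subset[OF indep]]) auto
  have "(\<integral>\<^sup>+\<omega>. ennreal (exp (\<Sum>i<n. w i * \<epsilon> i \<omega>)) \<partial>M) = (\<integral>\<^sup>+\<omega>. (\<Prod>i<n. ennreal (exp (w i * \<epsilon> i \<omega>))) \<partial>M)"
    by (simp add: exp_sum prod_ennreal)
  also have "\<dots> = (\<Prod>i<n. \<integral>\<^sup>+\<omega>. ennreal (exp (w i * \<epsilon> i \<omega>)) \<partial>M)"
    by (rule indep_vars_nn_integral[OF _ I]) auto
  also have "\<dots> = ennreal (exp (\<Sum>i<n. \<sigma>\<^sup>2 / 2 * (w i)\<^sup>2))"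
    unfolding mgf_noise by (simp add: prod_ennreal exp_sum)
  finally show ?thesis by (simp add: sum_distrib_left)
qed

text \<open>Markov's inequality for the exponential of \<open>s\<close> times the sum. The parameter
  \<open>s\<close> is left free because \<open>noise_square_tail\<close> and
  \<open>noise_tail_quadratic\<close> optimise it for different thresholds.\<close>

lemma noise_tail:
  fixes w :: "nat \<Rightarrow> real"
  assumes s: "s \<ge> 0"
  shows "measure M {\<omega> \<in> space M. (\<Sum>i<n. w i * \<epsilon> i \<omega>) \<ge> t} \<le> exp (\<sigma>\<^sup>2 * s\<^sup>2 / 2 * (\<Sum>i<n. (w i)\<^sup>2) - s * t)"
proof -
  have "emeasure M {\<omega> \<in> space M. (\<Sum>i<n. w i * \<epsilon> i \<omega>) \<ge> t}
      \<le> emeasure M {\<omega> \<in> space M. 1 \<le> ennreal (exp (- (s * t))) * ennreal (exp (\<Sum>i<n. (s * w i) * \<epsilon> i \<omega>))}"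
  proof (rule emeasure_mono)
    show "{\<omega> \<in> space M. (\<Sum>i<n. w i * \<epsilon> i \<omega>) \<ge> t}
      \<subseteq> {\<omega> \<in> space M. 1 \<le> ennreal (exp (- (s * t))) * ennreal (exp (\<Sum>i<n. (s * w i) * \<epsilon> i \<omega>))}"
    proof safe
      fix \<omega> assume "t \<le> (\<Sum>i<n. w i * \<epsilon> i \<omega>)"
      from mult_left_mono[OF this s] have "0 \<le> - (s * t) + (\<Sum>i<n. (s * w i) * \<epsilon> i \<omega>)"
        by (simp add: sum_distrib_left mult.assoc)
      then have "1 \<le> exp (- (s * t)) * exp (\<Sum>i<n. (s * w i) * \<epsilon> i \<omega>)"
        unfolding exp_add[symmetric] by simp
      then show "1 \<le> ennreal (exp (- (s * t))) * ennreal (exp (\<Sum>i<n. (s * w i) * \<epsilon> i \<omega>))"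
        by (simp add: ennreal_mult[symmetric])
    qed
  qed measurable
  also have "\<dots> \<le> ennreal (exp (- (s * t))) * (\<integral>\<^sup>+\<omega>. ennreal (exp (\<Sum>i<n. (s * w i) * \<epsilon> i \<omega>)) * indicator (space M) \<omega> \<partial>M)"
    by (rule nn_integral_Markov_inequality) measurable
  also have "(\<integral>\<^sup>+\<omega>. ennreal (exp (\<Sum>i<n. (s * w i) * \<epsilon> i \<omega>)) * indicator (space M) \<omega> \<partial>M)
      = (\<integral>\<^sup>+\<omega>. ennreal (exp (\<Sum>i<n. (s * w i) * \<epsilon> i \<omega>)) \<partial>M)"
    by (rule nn_integral_cong) simp
  also have "\<dots> = ennreal (exp (\<sigma>\<^sup>2 / 2 * (\<Sum>i<n. (s * w i)\<^sup>2)))"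
    by (rule mgf_noise_sum)
  also have "ennreal (exp (- (s * t))) * \<dots> = ennreal (exp (\<sigma>\<^sup>2 * s\<^sup>2 / 2 * (\<Sum>i<n. (w i)\<^sup>2) - s * t))"
    by (simp add: ennreal_mult[symmetric] exp_add[symmetric] power_mult_distrib sum_distrib_left mult_ac)
  finally show ?thesis
    by (simp add: emeasure_eq_measure)
qed

end

section \<open>Laplace transform of sums of squares\<close>

lemma integral_std_normal_exp_square:
  assumes c: "c \<ge> 0"
  shows "(LINT g|std_normal_distribution. exp (- (c * g\<^sup>2))) = (1 + 2 * c) powr (- 1 / 2)"
proof -
  let ?v = "1 / sqrt (1 + 2 * c)"
  have *: "std_normal_density g * exp (- (c * g\<^sup>2)) = ?v * normal_density 0 ?v g" for g
  proof -
    \<comment> \<open>The weight only changes the variance from 1 to \<open>1 / (1 + 2 * c)\<close>,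
      so the integral is a ratio of normalising constants.\<close>
    have "- g\<^sup>2 / 2 - c * g\<^sup>2 = - g\<^sup>2 / (2 * ?v\<^sup>2)"
      using c by (simp add: power_divide algebra_simps add_divide_distrib)
    moreover have "sqrt (2 * pi * ?v\<^sup>2) = sqrt (2 * pi) * ?v"
      using c by (simp add: real_sqrt_mult)
    ultimately show ?thesis
      using c by (simp add: normal_density_def mult.assoc exp_add[symmetric])
  qed
  have "(LINT g|std_normal_distribution. exp (- (c * g\<^sup>2))) = (LINT g|lborel. ?v * normal_density 0 ?v g)"
    by (subst integral_density) (simp_all add: *)
  also have "\<dots> = ?v"
    using c by (simp add: integral_normal_density)
  finally show ?thesis
    using c powr_half_sqrt[of "1 + 2 * c"] powr_minus[of "1 + 2 * c" "1 / 2"]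
    unfolding minus_divide_left by (simp only: inverse_eq_divide)
qed

context gaussian_noise
begin

text \<open>
  The linear term makes the induction on \<open>m\<close> work without rotation invariance of the Gaussian law: a factor
  \<open>exp (- s z\<^sup>2)\<close> is the mean of \<open>exp (\<i> sqrt (2 s) g z)\<close> over an independent standard normal \<open>g\<close>,
  so by Fubini it only changes \<open>w\<close>.
\<close>

lemma laplace_char_noise:
  fixes u :: "nat \<Rightarrow> nat \<Rightarrow> real" and w :: "nat \<Rightarrow> real"
  assumes s: "s \<ge> 0"
    and orth: "\<And>l l'. l < m \<Longrightarrow> l' < m \<Longrightarrow> (\<Sum>i<n. u l i * u l' i) = (if l = l' then 1 else 0)"
    and w: "\<And>l. l < m \<Longrightarrow> (\<Sum>i<n. u l i * w i) = 0"
  shows "(CLINT \<omega>|M. of_real (exp (- (s * (\<Sum>l<m. (\<Sum>i<n. u l i * \<epsilon> i \<omega>)\<^sup>2)))) * iexp (\<Sum>i<n. w i * \<epsilon> i \<omega>))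
    = of_real ((1 + 2 * s * \<sigma>\<^sup>2) powr (- real m / 2) * exp (- (\<sigma>\<^sup>2 / 2 * (\<Sum>i<n. (w i)\<^sup>2))))"
  using orth w
proof (induction m arbitrary: w)
  case 0
  \<comment> \<open>The base must be shown nonzero, because \<open>0 powr 0\<close> is 0.\<close>
  then show ?case using s sigma char_noise_sum[of w n] 
    by (simp add: add_nonneg_eq_0_iff)
next
  case (Suc m)
  let ?N = "std_normal_distribution"
  let ?Z = "\<lambda>\<omega>. \<Sum>i<n. u m i * \<epsilon> i \<omega>"
  let ?E = "\<lambda>\<omega>. exp (- (s * (\<Sum>l<m. (\<Sum>i<n. u l i * \<epsilon> i \<omega>)\<^sup>2)))"
  let ?W = "\<lambda>\<omega>. \<Sum>i<n. w i * \<epsilon> i \<omega>"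
  let ?r = "sqrt (2 * s)"
  interpret N: real_distribution ?N by (rule real_dist_normal_dist)
  interpret pair_prob_space M ?N ..
  have char: "of_real (exp (- (t * x\<^sup>2))) = (CLINT g|?N. iexp (g * (sqrt (2 * t) * x)))" if "t \<ge> 0" for x t :: real
    using fun_cong[OF char_std_normal_distribution, of "sqrt (2 * t) * x"] that
    by (simp add: char_def power_mult_distrib mult_ac)
  \<comment> \<open>The cross term vanishes because \<open>u m\<close> is orthogonal to
    \<open>w\<close>, and \<open>u m\<close> has unit length; hence only
    \<open>2 * s * g\<^sup>2\<close> is added.\<close>
  have wg: "(\<Sum>i<n. (w i + g * ?r * u m i)\<^sup>2) = (\<Sum>i<n. (w i)\<^sup>2) + 2 * s * g\<^sup>2" for g
  proof -
    have "(\<Sum>i<n. (w i + g * ?r * u m i)\<^sup>2)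
        = (\<Sum>i<n. (w i)\<^sup>2) + 2 * g * ?r * (\<Sum>i<n. u m i * w i) + (g * ?r)\<^sup>2 * (\<Sum>i<n. u m i * u m i)"
      by (simp add: power2_sum sum.distrib sum_distrib_left power_mult_distrib power2_eq_square algebra_simps)
    then show ?thesis using Suc.prems s by (simp add: power_mult_distrib)
  qed
  have E: "exp (- (s * (\<Sum>l<Suc m. (\<Sum>i<n. u l i * \<epsilon> i \<omega>)\<^sup>2))) = ?E \<omega> * exp (- (s * (?Z \<omega>)\<^sup>2))" for \<omega>
    by (simp only: sum.lessThan_Suc distrib_left minus_add_distrib exp_add)
  have W: "(\<Sum>i<n. (w i + g * ?r * u m i) * \<epsilon> i \<omega>) = ?W \<omega> + g * (?r * ?Z \<omega>)" for g \<omega>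
    by (simp only: distrib_right sum.distrib sum_distrib_left mult.assoc)
  have eq: "of_real (exp (- (s * (\<Sum>l<Suc m. (\<Sum>i<n. u l i * \<epsilon> i \<omega>)\<^sup>2)))) * iexp (?W \<omega>)
      = (CLINT g|?N. of_real (?E \<omega>) * iexp (\<Sum>i<n. (w i + g * ?r * u m i) * \<epsilon> i \<omega>))" for \<omega>
    unfolding E W of_real_mult of_real_add distrib_left exp_add mult.assoc[symmetric]
      char[OF s] integral_mult_right_zero
    by (simp only: mult_ac)
  \<comment> \<open>The shifted \<open>w\<close> is still orthogonal to the remaining
    \<open>u l\<close>, as the induction hypothesis demands.\<close>
  have orth: "(\<Sum>i<n. u l i * (w i + g * ?r * u m i)) = 0" if "l < m" for g l
  proof -
    have "(\<Sum>i<n. u l i * (w i + g * ?r * u m i))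
        = (\<Sum>i<n. u l i * w i) + g * ?r * (\<Sum>i<n. u l i * u m i)"
      by (simp only: distrib_left sum.distrib sum_distrib_left mult_ac)
    then show ?thesis
      using Suc.prems(1)[of l m] Suc.prems(2)[of l] that by simp
  qed
  let ?c = "1 + 2 * s * \<sigma>\<^sup>2"
  let ?a = "?c powr (- real m / 2) * exp (- (\<sigma>\<^sup>2 / 2 * (\<Sum>i<n. (w i)\<^sup>2)))"
  have IH: "(CLINT \<omega>|M. of_real (?E \<omega>) * iexp (\<Sum>i<n. (w i + g * ?r * u m i) * \<epsilon> i \<omega>))
      = of_real (?a * exp (- (\<sigma>\<^sup>2 * s * g\<^sup>2)))" for g
  proof -
    have "exp (- (\<sigma>\<^sup>2 / 2 * (\<Sum>i<n. (w i + g * ?r * u m i)\<^sup>2)))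
        = exp (- (\<sigma>\<^sup>2 / 2 * (\<Sum>i<n. (w i)\<^sup>2))) * exp (- (\<sigma>\<^sup>2 * s * g\<^sup>2))"
      unfolding wg exp_add[symmetric] by (simp add: distrib_left)
    then show ?thesis
      by (subst Suc.IH) (use Suc.prems orth in \<open>auto simp: mult.assoc\<close>)
  qed
  have "(CLINT \<omega>|M. of_real (exp (- (s * (\<Sum>l<Suc m. (\<Sum>i<n. u l i * \<epsilon> i \<omega>)\<^sup>2)))) * iexp (?W \<omega>))
      = (CLINT \<omega>|M. CLINT g|?N. of_real (?E \<omega>) * iexp (\<Sum>i<n. (w i + g * ?r * u m i) * \<epsilon> i \<omega>))"
    unfolding eq ..
  also have "\<dots> = (CLINT g|?N. CLINT \<omega>|M. of_real (?E \<omega>) * iexp (\<Sum>i<n. (w i + g * ?r * u m i) * \<epsilon> i \<omega>))"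
    \<comment> \<open>The integrand has modulus at most 1 on a product of probability spaces, hence
      is integrable.\<close>
    by (intro Fubini_integral[symmetric] P.integrable_const_bound[of _ 1])
       (auto simp: norm_mult s sum_nonneg split_beta' simp del: of_real_sum)
  also have "\<dots> = (CLINT g|?N. of_real (?a * exp (- (\<sigma>\<^sup>2 * s * g\<^sup>2))))"
    unfolding IH ..
  also have "\<dots> = of_real (?a * (LINT g|?N. exp (- (\<sigma>\<^sup>2 * s * g\<^sup>2))))"
    unfolding integral_complex_of_real integral_mult_right_zero ..
  also have "(LINT g|?N. exp (- (\<sigma>\<^sup>2 * s * g\<^sup>2))) = ?c powr (- 1 / 2)"
    using integral_std_normal_exp_square[of "\<sigma>\<^sup>2 * s"] s by (simp add: mult_ac)
  also have "?a * ?c powr (- 1 / 2) = ?c powr (- real (Suc m) / 2) * exp (- (\<sigma>\<^sup>2 / 2 * (\<Sum>i<n. (w i)\<^sup>2)))"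
  proof -
    have "?c powr (- real (Suc m) / 2) = ?c powr (- real m / 2 + - 1 / 2)"
      by (simp add: field_simps)
    then show ?thesis
      unfolding powr_add by simp
  qed
  finally show ?case .
qed

end

text \<open>The difference of the two sides has derivative \<open>y\<^sup>2 / (1 + y)\<close>. This
  estimate produces the constant 4 in the chi-square exponent.\<close>

lemma ln_one_plus_ge_quadratic:
  fixes x :: real
  assumes "x \<ge> 0"
  shows "x - x\<^sup>2 / 2 \<le> ln (1 + x)"
proof -
  let ?g = "\<lambda>x. ln (1 + x) - x + x\<^sup>2 / 2 :: real"
  have "?g 0 \<le> ?g x"
  proof (rule DERIV_nonneg_imp_nondecreasing[OF assms])
    fix y :: real assume y: "0 \<le> y" "y \<le> x"
    have "(?g has_real_derivative (1 / (1 + y) - 1 + y)) (at y)"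
      using y by (auto intro!: derivative_eq_intros)
    moreover have "1 / (1 + y) - 1 + y = y\<^sup>2 / (1 + y)"
      using y by (simp add: field_simps power2_eq_square)
    ultimately show "\<exists>z. (?g has_real_derivative z) (at y) \<and> 0 \<le> z"
      using y by (auto intro!: exI[of _ "1 / (1 + y) - 1 + y"])
  qed
  then show ?thesis by simp
qed

section \<open>Exponential tail bounds\<close>

context gaussian_noise
begin

text \<open>Markov's inequality for \<open>exp (- (s * ?X \<omega>))\<close>, whose mean is
  \<open>laplace_char_noise\<close> at \<open>w = 0\<close>.\<close>

lemma chi_square_lower_tail:
  fixes u :: "nat \<Rightarrow> nat \<Rightarrow> real"
  assumes orth: "\<And>l l'. l < m \<Longrightarrow> l' < m \<Longrightarrow> (\<Sum>i<n. u l i * u l' i) = (if l = l' then 1 else 0)"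
    and m: "m > 0" and t: "t \<ge> 0"
  shows "measure M {\<omega> \<in> space M. (\<Sum>l<m. (\<Sum>i<n. u l i * \<epsilon> i \<omega>)\<^sup>2) \<le> \<sigma>\<^sup>2 * (real m - t)}
    \<le> exp (- (t\<^sup>2 / (4 * real m)))"
proof -
  let ?X = "\<lambda>\<omega>. \<Sum>l<m. (\<Sum>i<n. u l i * \<epsilon> i \<omega>)\<^sup>2"
  \<comment> \<open>This \<open>s\<close> minimises the exponent once
    \<open>ln (1 + 2 * s * \<sigma>\<^sup>2)\<close> is replaced by its quadratic lower
    bound.\<close>
  define s where "s = t / (2 * real m * \<sigma>\<^sup>2)"
  have s: "s \<ge> 0" using t by (simp add: s_def)
  have ss: "2 * s * \<sigma>\<^sup>2 = t / real m" using sigma by (simp add: s_def)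
  have "complex_of_real (LINT \<omega>|M. exp (- (s * ?X \<omega>))) = of_real ((1 + t / real m) powr (- real m / 2))"
    using laplace_char_noise[where w = "\<lambda>_. 0", OF s orth] unfolding ss integral_complex_of_real[symmetric] by simp
  then have L: "(LINT \<omega>|M. exp (- (s * ?X \<omega>))) = (1 + t / real m) powr (- real m / 2)"
    unfolding of_real_eq_iff .
  have int: "integrable M (\<lambda>\<omega>. exp (- (s * ?X \<omega>)))"
    by (rule integrable_const_bound[of _ 1]) (auto simp: s sum_nonneg)
  have "measure M {\<omega> \<in> space M. ?X \<omega> \<le> \<sigma>\<^sup>2 * (real m - t)}
      \<le> measure M {\<omega> \<in> space M. exp (- (s * ?X \<omega>)) \<ge> exp (- (s * (\<sigma>\<^sup>2 * (real m - t))))}"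
    by (rule finite_measure_mono) (auto intro!: mult_left_mono s)
  also have "\<dots> \<le> (1 + t / real m) powr (- real m / 2) / exp (- (s * (\<sigma>\<^sup>2 * (real m - t))))"
    unfolding L[symmetric] by (rule integral_Markov_inequality_measure[OF int]) auto
  also have "\<dots> = exp (s * \<sigma>\<^sup>2 * (real m - t) - real m / 2 * ln (1 + t / real m))"
  proof -
    have ne: "1 + t / real m \<noteq> 0"
      using divide_nonneg_nonneg[OF t, of "real m"] by linarith
    show ?thesis
      unfolding powr_def if_not_P[OF ne] exp_diff[symmetric] by simp
  qed
  also have "\<dots> \<le> exp (- (t\<^sup>2 / (4 * real m)))"
  proof -
    have "real m / 2 * (t / real m - (t / real m)\<^sup>2 / 2) \<le> real m / 2 * ln (1 + t / real m)"
      using t by (intro mult_left_mono ln_one_plus_ge_quadratic) auto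
    moreover have "real m / 2 * (t / real m - (t / real m)\<^sup>2 / 2) = t / 2 - t\<^sup>2 / (4 * real m)"
      using m by (simp add: field_simps power2_eq_square)
    moreover have "s * \<sigma>\<^sup>2 * (real m - t) = t / 2 - t\<^sup>2 / (2 * real m)"
      using m sigma by (simp add: s_def field_simps power2_eq_square)
    moreover have "t\<^sup>2 / (2 * real m) = 2 * (t\<^sup>2 / (4 * real m))"
      by simp
    ultimately show ?thesis unfolding exp_le_cancel_iff by linarith
  qed
  finally show ?thesis .
qed

text \<open>The bound \<open>noise_tail\<close> for \<open>w\<close> and for \<open>- w\<close>; the
  choice of \<open>?s\<close> minimises the exponent, and the factor 2 comes from the two
  signs.\<close>

lemma noise_square_tail:
  fixes w :: "nat \<Rightarrow> real"
  assumes w: "(\<Sum>i<n. (w i)\<^sup>2) = 1" and t: "t \<ge> 0"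
  shows "measure M {\<omega> \<in> space M. (\<Sum>i<n. w i * \<epsilon> i \<omega>)\<^sup>2 \<ge> \<sigma>\<^sup>2 * t} \<le> 2 * exp (- t / 2)"
proof -
  let ?X = "\<lambda>\<omega>. \<Sum>i<n. w i * \<epsilon> i \<omega>"
  let ?Y = "\<lambda>\<omega>. \<Sum>i<n. (- w i) * \<epsilon> i \<omega>"
  let ?s = "sqrt t / \<sigma>"
  have b: "\<sigma>\<^sup>2 * ?s\<^sup>2 / 2 * 1 - ?s * (\<sigma> * sqrt t) = - t / 2"
    using sigma t by (simp add: power_divide field_simps)
  have s: "?s \<ge> 0" using sigma t by simp
  have "\<sigma> * sqrt t \<le> \<bar>?X \<omega>\<bar>" if "\<sigma>\<^sup>2 * t \<le> (?X \<omega>)\<^sup>2" for \<omega>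
    using real_sqrt_le_mono[OF that] sigma t by (simp add: real_sqrt_mult)
  then have "{\<omega> \<in> space M. (?X \<omega>)\<^sup>2 \<ge> \<sigma>\<^sup>2 * t}
      \<subseteq> {\<omega> \<in> space M. ?X \<omega> \<ge> \<sigma> * sqrt t} \<union> {\<omega> \<in> space M. ?Y \<omega> \<ge> \<sigma> * sqrt t}"
    by (force simp: sum_negf abs_if split: if_splits)
  then have "measure M {\<omega> \<in> space M. (?X \<omega>)\<^sup>2 \<ge> \<sigma>\<^sup>2 * t}
      \<le> measure M ({\<omega> \<in> space M. ?X \<omega> \<ge> \<sigma> * sqrt t} \<union> {\<omega> \<in> space M. ?Y \<omega> \<ge> \<sigma> * sqrt t})"
    by (rule finite_measure_mono) measurable
  also have "\<dots> \<le> measure M {\<omega> \<in> space M. ?X \<omega> \<ge> \<sigma> * sqrt t} + measure M {\<omega> \<in> space M. ?Y \<omega> \<ge> \<sigma> * sqrt t}"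
    by (rule measure_Un_le) measurable
  also have "\<dots> \<le> exp (- t / 2) + exp (- t / 2)"
    using noise_tail[OF s, where w=w and n=n and t="\<sigma> * sqrt t"]
      noise_tail[OF s, where w="\<lambda>i. - w i" and n=n and t="\<sigma> * sqrt t"]
    unfolding power2_minus w b by (rule add_mono)
  finally show ?thesis by simp
qed

text \<open>The bound on the variance and the deviation are both proportional to \<open>c\<close>,
  so the exponent is linear in \<open>c\<close>. Here \<open>?s\<close> minimises
  \<open>\<sigma>\<^sup>2 * s\<^sup>2 / 2 * (\<sigma>\<^sup>2 * c) - s * ?t\<close>.\<close>

lemma noise_tail_quadratic:
  fixes w :: "nat \<Rightarrow> real"
  assumes w: "(\<Sum>i<n. (w i)\<^sup>2) \<le> \<sigma>\<^sup>2 * c" and \<eta>: "\<eta> \<ge> 0"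
  shows "measure M {\<omega> \<in> space M. 2 * (\<Sum>i<n. w i * \<epsilon> i \<omega>) \<le> - (\<eta> * \<sigma>\<^sup>2 * c)} \<le> exp (- (\<eta>\<^sup>2 * c / 8))"
proof -
  let ?s = "\<eta> / (2 * \<sigma>\<^sup>2)" and ?t = "\<eta> * \<sigma>\<^sup>2 * c / 2"
  have s: "?s \<ge> 0" using \<eta> by simp
  have "{\<omega> \<in> space M. 2 * (\<Sum>i<n. w i * \<epsilon> i \<omega>) \<le> - (\<eta> * \<sigma>\<^sup>2 * c)}
      = {\<omega> \<in> space M. (\<Sum>i<n. (- w i) * \<epsilon> i \<omega>) \<ge> ?t}"
    by (auto simp: sum_negf field_simps)
  then have "measure M {\<omega> \<in> space M. 2 * (\<Sum>i<n. w i * \<epsilon> i \<omega>) \<le> - (\<eta> * \<sigma>\<^sup>2 * c)}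
      \<le> exp (\<sigma>\<^sup>2 * ?s\<^sup>2 / 2 * (\<Sum>i<n. (w i)\<^sup>2) - ?s * ?t)"
    using noise_tail[OF s, where w="\<lambda>i. - w i" and n=n and t="?t"] by simp
  also have "\<dots> \<le> exp (\<sigma>\<^sup>2 * ?s\<^sup>2 / 2 * (\<sigma>\<^sup>2 * c) - ?s * ?t)"
    using w by (simp add: mult_left_mono)
  also have "\<sigma>\<^sup>2 * ?s\<^sup>2 / 2 * (\<sigma>\<^sup>2 * c) - ?s * ?t = - (\<eta>\<^sup>2 * c / 8)"
    using sigma by (simp add: field_simps power2_eq_square)
  finally show ?thesis .
qed

end

section \<open>Orthogonal projections\<close>

definition orthonormal :: "nat \<Rightarrow> real vec list \<Rightarrow> bool" where
  "orthonormal n us \<longleftrightarrow> set us \<subseteq> carrier_vec n \<and>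
     (\<forall>i<length us. \<forall>j<length us. (us ! i) \<bullet> (us ! j) = (if i = j then 1 else 0))"

text \<open>For an orthonormal list this is the orthogonal projection onto its span.\<close>

definition frame_proj :: "nat \<Rightarrow> real vec list \<Rightarrow> real mat" where
  "frame_proj n us = mat_of_cols n us * (mat_of_cols n us)\<^sup>T"

definition subspace_of :: "nat \<Rightarrow> real vec set \<Rightarrow> bool" where
  "subspace_of n V \<longleftrightarrow> V \<subseteq> carrier_vec n \<and> 0\<^sub>v n \<in> V \<and> (\<forall>v\<in>V. \<forall>w\<in>V. v + w \<in> V) \<and> (\<forall>c. \<forall>v\<in>V. c \<cdot>\<^sub>v v \<in> V)"

lemma sq_length_nonneg: "sq_length v \<ge> 0"
  by (simp add: sq_length_def scalar_prod_def sum_nonneg)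

lemma sq_length_eq_0_iff: "v \<in> carrier_vec n \<Longrightarrow> sq_length v = 0 \<longleftrightarrow> v = 0\<^sub>v n"
  by (auto simp: sq_length_def scalar_prod_def sum_nonneg_eq_0_iff)

lemma sq_length_eq_sum: "u \<in> carrier_vec n \<Longrightarrow> sq_length u = (\<Sum>i<n. (u $ i)\<^sup>2)"
  by (simp add: sq_length_def scalar_prod_def power2_eq_square lessThan_atLeast0)

lemma mult_unit_vec_index:
  fixes P :: "real mat"
  shows "P \<in> carrier_mat n n \<Longrightarrow> i < n \<Longrightarrow> j < n \<Longrightarrow> (P *\<^sub>v unit_vec n j) $ i = P $$ (i, j)"
  by auto

lemma frame_proj_carrier [simp]: "frame_proj n us \<in> carrier_mat n n"
  by (simp add: frame_proj_def carrier_matI)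

lemma carrier_vec_frame [simp]:
  "mat_of_cols n us *\<^sub>v x \<in> carrier_vec n"
  "(mat_of_cols n us)\<^sup>T *\<^sub>v x \<in> carrier_vec (length us)"
  "frame_proj n us *\<^sub>v x \<in> carrier_vec n"
  by (auto intro!: carrier_vecI simp: frame_proj_def)

lemma transpose_frame_proj [simp]: "(frame_proj n us)\<^sup>T = frame_proj n us"
  unfolding frame_proj_def by (subst transpose_mult[where nr = n and n = "length us" and nc = n]) auto

lemma orthonormal_gram:
  assumes "orthonormal n us"
  shows "(mat_of_cols n us)\<^sup>T * mat_of_cols n us = 1\<^sub>m (length us)"
proof (rule eq_matI)
  fix i j assume "i < dim_row (1\<^sub>m (length us))" "j < dim_col (1\<^sub>m (length us))"
  moreover have "us ! l \<in> carrier_vec n" if "l < length us" for l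
    using assms that by (auto simp: orthonormal_def)
  ultimately show "((mat_of_cols n us)\<^sup>T * mat_of_cols n us) $$ (i, j) = 1\<^sub>m (length us) $$ (i, j)"
    using assms by (simp add: orthonormal_def)
qed auto

lemma frame_proj_alt:
  "v \<in> carrier_vec n \<Longrightarrow> frame_proj n us *\<^sub>v v = mat_of_cols n us *\<^sub>v ((mat_of_cols n us)\<^sup>T *\<^sub>v v)"
  unfolding frame_proj_def by (rule assoc_mult_mat_vec[of _ n "length us" _ n]) auto

lemma frame_proj_fixes_frame:
  assumes "orthonormal n us" "x \<in> carrier_vec (length us)"
  shows "frame_proj n us *\<^sub>v (mat_of_cols n us *\<^sub>v x) = mat_of_cols n us *\<^sub>v x"
proof -
  let ?U = "mat_of_cols n us"
  have "?U\<^sup>T *\<^sub>v (?U *\<^sub>v x) = (?U\<^sup>T * ?U) *\<^sub>v x"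
    using assms(2) by (intro assoc_mult_mat_vec[symmetric, of _ "length us" n _ "length us"]) auto
  then show ?thesis
    using assms by (simp add: orthonormal_gram frame_proj_alt)
qed

lemma frame_proj_idem:
  assumes "orthonormal n us" "v \<in> carrier_vec n"
  shows "frame_proj n us *\<^sub>v (frame_proj n us *\<^sub>v v) = frame_proj n us *\<^sub>v v"
  unfolding frame_proj_alt[OF assms(2)] by (rule frame_proj_fixes_frame) (use assms in auto)

text \<open>The trace is additive, so with this lemma the frame lengths of \<open>I - M_k\<close>
  and \<open>M_k - M_k'\<close> follow from the ranks of the models.\<close>

lemma trace_frame_proj:
  assumes "orthonormal n us"
  shows "(\<Sum>i<n. frame_proj n us $$ (i, i)) = real (length us)"
proof -
  have us: "us ! l \<in> carrier_vec n" "(us ! l) \<bullet> (us ! l) = 1" if "l < length us" for l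
    using assms that by (auto simp: orthonormal_def)
  have "(\<Sum>i<n. frame_proj n us $$ (i, i)) = (\<Sum>i<n. \<Sum>l<length us. (us ! l $ i :: real) * us ! l $ i)"
    by (simp add: frame_proj_def scalar_prod_def mat_of_cols_index lessThan_atLeast0)
  also have "\<dots> = (\<Sum>l<length us. (us ! l) \<bullet> (us ! l))"
    by (subst sum.swap) (auto simp: scalar_prod_def lessThan_atLeast0 carrier_vecD[OF us(1)] intro!: sum.cong)
  finally show ?thesis by (simp add: us(2))
qed

lemma scalar_prod_symmetric_mat:
  fixes P :: "real mat"
  assumes "P \<in> carrier_mat n n" "P\<^sup>T = P" "v \<in> carrier_vec n" "w \<in> carrier_vec n"
  shows "(P *\<^sub>v v) \<bullet> w = v \<bullet> (P *\<^sub>v w)"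
  using transpose_vec_mult_scalar[OF assms(1,4,3)] assms(2) by simp

text \<open>Parseval's identity. It brings projected errors into the form of a sum of squared linear
  forms, to which the tail bounds apply.\<close>

lemma sq_length_frame_proj:
  assumes "orthonormal n us" "v \<in> carrier_vec n"
  shows "sq_length (frame_proj n us *\<^sub>v v) = (\<Sum>l<length us. ((us ! l) \<bullet> v)\<^sup>2)"
proof -
  let ?U = "mat_of_cols n us"
  have us: "us ! l \<in> carrier_vec n" if "l < length us" for l
    using assms that by (auto simp: orthonormal_def)
  have "sq_length (frame_proj n us *\<^sub>v v) = v \<bullet> (frame_proj n us *\<^sub>v v)"
    unfolding sq_length_def using assms 
    by (subst scalar_prod_symmetric_mat[where n = n]) (auto simp: frame_proj_idem)
  also have "\<dots> = (?U\<^sup>T *\<^sub>v v) \<bullet> (?U\<^sup>T *\<^sub>v v)"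
    unfolding frame_proj_alt[OF assms(2)]
    by (rule transpose_vec_mult_scalar[symmetric]) (use assms in auto)
  also have "\<dots> = (\<Sum>l<length us. ((us ! l) \<bullet> v)\<^sup>2)"
    by (auto simp: scalar_prod_def[of "?U\<^sup>T *\<^sub>v v"] us power2_eq_square lessThan_atLeast0 intro!: sum.cong)
  finally show ?thesis .
qed

text \<open>The length is the trace of the projection. A diagonal entry \<open>p\<close> is the
  squared length of the \<open>i\<close>-th column, which contains \<open>p\<close> itself, so
  \<open>p^2 \<le> p\<close> and \<open>p \<le> 1\<close>.\<close>

lemma orthonormal_length_le:
  assumes "orthonormal n us"
  shows "length us \<le> n"
proof -
  let ?P = "frame_proj n us"
  have "?P $$ (i, i) \<le> 1" if i: "i < n" for i
  proof -
    have "?P $$ (i, i) = unit_vec n i \<bullet> (?P *\<^sub>v unit_vec n i)"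
      using i by (simp add: mult_unit_vec_index[OF frame_proj_carrier] del: index_mult_mat_vec)
    also have "\<dots> = sq_length (?P *\<^sub>v unit_vec n i)"
      unfolding sq_length_def using assms i
      by (subst scalar_prod_symmetric_mat[where n = n]) (auto simp: frame_proj_idem)
    finally have *: "?P $$ (i, i) = sq_length (?P *\<^sub>v unit_vec n i)" .
    have "(?P $$ (i, i))\<^sup>2 = ((?P *\<^sub>v unit_vec n i) $ i)\<^sup>2"
      using i by (simp add: mult_unit_vec_index[OF frame_proj_carrier] del: index_mult_mat_vec)
    also have "\<dots> \<le> sq_length (?P *\<^sub>v unit_vec n i)"
      unfolding sq_length_def scalar_prod_def power2_eq_square using i carrier_matD(1)[OF frame_proj_carrier[of n us]]
      by (intro member_le_sum[where f = "\<lambda>i. (?P *\<^sub>v unit_vec n _) $ i * (?P *\<^sub>v unit_vec n _) $ i"]) auto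
    finally have "?P $$ (i, i) * ?P $$ (i, i) \<le> ?P $$ (i, i) * 1"
      using * by (simp add: power2_eq_square)
    then show ?thesis
      using * sq_length_nonneg[of "?P *\<^sub>v unit_vec n i"] by (metis mult_left_le_imp_le zero_le_one less_eq_real_def)
  qed
  then have "(\<Sum>i<n. ?P $$ (i, i)) \<le> (\<Sum>i<n. 1)"
    by (intro sum_mono) auto
  then show ?thesis
    unfolding trace_frame_proj[OF assms] by simp
qed

lemma subspace_of_mat_of_cols:
  assumes V: "subspace_of n V" and us: "set us \<subseteq> V" and x: "x \<in> carrier_vec (length us)"
  shows "mat_of_cols n us *\<^sub>v x \<in> V"
  using us x
proof (induction us arbitrary: x)
  case Nil
  have "mat_of_cols n [] *\<^sub>v x = 0\<^sub>v n"
    using Nil by (intro eq_vecI) (auto simp: scalar_prod_def mult_mat_vec_def)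
  then show ?case using V by (simp add: subspace_of_def)
next
  case (Cons u us)
  let ?y = "vec (length us) (\<lambda>i. x $ Suc i)"
  have u: "u \<in> carrier_vec n" using Cons.prems V by (auto simp: subspace_of_def)
  have "mat_of_cols n (u # us) *\<^sub>v x = x $ 0 \<cdot>\<^sub>v u + mat_of_cols n us *\<^sub>v ?y"
    using u Cons.prems(2)
    by (intro eq_vecI)
       (auto simp: scalar_prod_def mat_of_cols_index sum.atLeast0_lessThan_Suc_shift simp del: sum.op_ivl_Suc)
  then show ?case
    using V Cons.prems(1) Cons.IH[of ?y] by (auto simp: subspace_of_def)
qed

lemma exists_orthonormal_frame:
  assumes V: "subspace_of n V"
  shows "\<exists>us. orthonormal n us \<and> set us \<subseteq> V \<and> (\<forall>v\<in>V. frame_proj n us *\<^sub>v v = v)"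
proof -
  \<comment> \<open>A longest orthonormal list in \<open>V\<close> works: otherwise a normalised residual could be appended.\<close>
  have "\<exists>k. (\<exists>us. orthonormal n us \<and> set us \<subseteq> V \<and> length us = k)
      \<and> (\<forall>k'. (\<exists>us. orthonormal n us \<and> set us \<subseteq> V \<and> length us = k') \<longrightarrow> k' \<le> k)"
    by (rule Nat.ex_has_greatest_nat[of _ 0 n])
       (auto simp: orthonormal_def[of n "[]"] dest: orthonormal_length_le)
  then obtain us where us: "orthonormal n us" "set us \<subseteq> V"
    and max: "\<And>us'. orthonormal n us' \<Longrightarrow> set us' \<subseteq> V \<Longrightarrow> length us' \<le> length us"
    by blast
  let ?U = "mat_of_cols n us" and ?P = "frame_proj n us"
  have "?P *\<^sub>v v = v" if v: "v \<in> V" for v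
  proof (rule ccontr)
    assume ne: "?P *\<^sub>v v \<noteq> v"
    have vc: "v \<in> carrier_vec n" using V v by (auto simp: subspace_of_def)
    have Pv: "?P *\<^sub>v v \<in> V" unfolding frame_proj_alt[OF vc]
      by (rule subspace_of_mat_of_cols[OF V us(2)]) auto
    then have Pvc: "?P *\<^sub>v v \<in> carrier_vec n" using V by (auto simp: subspace_of_def)
    \<comment> \<open>Written without subtraction, since \<open>subspace_of\<close> speaks of sums
      and scalar multiples only.\<close>
    define w where "w = v + (- 1) \<cdot>\<^sub>v (?P *\<^sub>v v)"
    have w: "w \<in> V" unfolding w_def using V v Pv by (auto simp: subspace_of_def)
    have wc: "w \<in> carrier_vec n" using V w by (auto simp: subspace_of_def)
    have w': "w = v - ?P *\<^sub>v v" unfolding w_def using vc Pvc by (intro eq_vecI) auto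
    have "w \<noteq> 0\<^sub>v n"
      using ne vc Pvc unfolding w' by (auto simp: vec_eq_iff)
    then have pos: "sq_length w > 0"
      using sq_length_nonneg[of w] sq_length_eq_0_iff[OF wc] by linarith
    \<comment> \<open>The projection is symmetric and fixes each \<open>us ! l\<close>, so the
      residual is orthogonal to the frame.\<close>
    have orth: "(us ! l) \<bullet> w = 0" if l: "l < length us" for l
    proof -
      have ul: "us ! l \<in> carrier_vec n" using us l by (auto simp: orthonormal_def)
      have "us ! l = ?U *\<^sub>v unit_vec (length us) l"
        using l ul by (intro eq_vecI) (auto simp: mat_of_cols_index)
      then have "?P *\<^sub>v (us ! l) = us ! l"
        using frame_proj_fixes_frame[OF us(1), of "unit_vec (length us) l"] by simp
      then have "(us ! l) \<bullet> (?P *\<^sub>v v) = (us ! l) \<bullet> v"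
        using scalar_prod_symmetric_mat[of ?P n "us ! l" v] ul vc by simp
      then show ?thesis
        unfolding w' using ul vc Pvc by (simp add: scalar_prod_minus_distrib[where n = n])
    qed
    define u where "u = (1 / sqrt (sq_length w)) \<cdot>\<^sub>v w"
    have "u \<bullet> u = 1"
      using wc pos unfolding u_def sq_length_def by (simp add: power2_eq_square[symmetric])
    moreover have "(us ! l) \<bullet> u = 0" "u \<bullet> (us ! l) = 0" if "l < length us" for l
    proof -
      have ul: "us ! l \<in> carrier_vec n" using us that by (auto simp: orthonormal_def)
      show "(us ! l) \<bullet> u = 0" using orth[OF that] wc ul unfolding u_def by simp
      then show "u \<bullet> (us ! l) = 0" using wc ul unfolding u_def by (subst comm_scalar_prod[of _ n]) auto
    qed
    ultimately have "orthonormal n (us @ [u])"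
      using us(1) wc unfolding orthonormal_def u_def by (auto simp: nth_append less_Suc_eq)
    moreover have "set (us @ [u]) \<subseteq> V"
      using us(2) w V unfolding u_def by (auto simp: subspace_of_def)
    ultimately show False using max[of "us @ [u]"] by simp
  qed
  then show ?thesis using us by blast
qed

text \<open>Symmetry moves the projection onto \<open>w\<close>, which it fixes. This is the
  existence half behind the \<open>THE\<close> in \<open>proj_mat\<close>.\<close>

lemma is_orthogonal_projection_frame_proj:
  assumes V: "subspace_of n V" and us: "orthonormal n us" "set us \<subseteq> V" "\<And>v. v \<in> V \<Longrightarrow> frame_proj n us *\<^sub>v v = v"
  shows "is_orthogonal_projection n (frame_proj n us) V"
  unfolding is_orthogonal_projection_def
proof (intro conjI ballI frame_proj_carrier)
  fix v :: "real vec" assume v: "v \<in> carrier_vec n"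
  let ?P = "frame_proj n us"
  show Pv: "?P *\<^sub>v v \<in> V"
    unfolding frame_proj_alt[OF v] by (rule subspace_of_mat_of_cols[OF V us(2)]) auto
  fix w assume w: "w \<in> V"
  then have wc: "w \<in> carrier_vec n" using V by (auto simp: subspace_of_def)
  have Pvc: "?P *\<^sub>v v \<in> carrier_vec n" using Pv V by (auto simp: subspace_of_def)
  have "(?P *\<^sub>v v) \<bullet> w = v \<bullet> w"
    using scalar_prod_symmetric_mat[of ?P n v w] v wc us(3)[OF w] by simp
  then show "(v - ?P *\<^sub>v v) \<bullet> w = 0"
    using v wc Pvc by (simp add: minus_scalar_prod_distrib[where n = n])
qed

text \<open>The difference of the two images of \<open>v\<close> lies in \<open>V\<close>, and both
  residuals are orthogonal to \<open>V\<close>; so the difference is orthogonal to itself.\<close>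

lemma is_orthogonal_projection_unique:
  assumes V: "subspace_of n V" and P: "is_orthogonal_projection n P V" and Q: "is_orthogonal_projection n Q V"
  shows "P = Q"
proof (rule eq_matI)
  have PQ: "P \<in> carrier_mat n n" "Q \<in> carrier_mat n n"
    using P Q by (auto simp: is_orthogonal_projection_def)
  show "dim_row P = dim_row Q" "dim_col P = dim_col Q" using PQ by auto
  have eq: "P *\<^sub>v v = Q *\<^sub>v v" if v: "v \<in> carrier_vec n" for v
  proof -
    have V': "P *\<^sub>v v \<in> V" "Q *\<^sub>v v \<in> V"
      using P Q v by (auto simp: is_orthogonal_projection_def)
    define d where "d = P *\<^sub>v v + (- 1) \<cdot>\<^sub>v (Q *\<^sub>v v)"
    have d: "d \<in> V" using V V' by (auto simp: subspace_of_def d_def)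
    have c: "P *\<^sub>v v \<in> carrier_vec n" "Q *\<^sub>v v \<in> carrier_vec n" "d \<in> carrier_vec n"
      using V V' d by (auto simp: subspace_of_def)
    have d': "d = P *\<^sub>v v - Q *\<^sub>v v" unfolding d_def using c by (intro eq_vecI) auto
    have "(v - P *\<^sub>v v) \<bullet> d = 0" "(v - Q *\<^sub>v v) \<bullet> d = 0"
      using P Q v d by (auto simp: is_orthogonal_projection_def)
    then have "sq_length d = 0"
      unfolding sq_length_def using c v
      by (subst (1) d') (simp add: minus_scalar_prod_distrib[where n = n])
    then have "d = 0\<^sub>v n" using sq_length_eq_0_iff[OF c(3)] by simp
    then show ?thesis unfolding d' using c PQ
      by (auto simp: vec_eq_iff)
  qed
  fix i j assume "i < dim_row Q" "j < dim_col Q"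
  then have ij: "i < n" "j < n" using PQ by auto
  have "P $$ (i, j) = (P *\<^sub>v unit_vec n j) $ i" "Q $$ (i, j) = (Q *\<^sub>v unit_vec n j) $ i"
    using PQ ij by auto
  then show "P $$ (i, j) = Q $$ (i, j)" using eq by simp
qed

lemma vec_minus_minus_self:
  fixes x y :: "real vec"
  shows "x \<in> carrier_vec n \<Longrightarrow> y \<in> carrier_vec n \<Longrightarrow> x - (y - y) = x"
  by (intro eq_vecI) auto

text \<open>Such a matrix is the orthogonal projection onto its fixed space. It is applied to
  \<open>I - M_k\<close> and to \<open>M_k - M_k'\<close>.\<close>

lemma symmetric_idempotent_frame:
  fixes Q :: "real mat"
  assumes Q: "Q \<in> carrier_mat n n" "Q\<^sup>T = Q" and idem: "\<And>v. v \<in> carrier_vec n \<Longrightarrow> Q *\<^sub>v (Q *\<^sub>v v) = Q *\<^sub>v v"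
  shows "\<exists>us. orthonormal n us \<and> Q = frame_proj n us"
proof -
  let ?V = "{v \<in> carrier_vec n. Q *\<^sub>v v = v}"
  have Qc: "Q *\<^sub>v v \<in> carrier_vec n" for v
    using Q(1) by (auto intro: carrier_vecI)
  have Q0: "Q *\<^sub>v 0\<^sub>v n = 0\<^sub>v n"
    using Q(1) by (intro eq_vecI) auto
  have V: "subspace_of n ?V"
    using Q(1) Q0 by (auto simp: subspace_of_def mult_add_distrib_mat_vec mult_mat_vec)
  obtain us where us: "orthonormal n us" "set us \<subseteq> ?V" "\<And>v. v \<in> ?V \<Longrightarrow> frame_proj n us *\<^sub>v v = v"
    using exists_orthonormal_frame[OF V] by blast
  have "is_orthogonal_projection n Q ?V"
    unfolding is_orthogonal_projection_def
  proof (intro conjI ballI Q(1))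
    fix v :: "real vec" assume v: "v \<in> carrier_vec n"
    then show "Q *\<^sub>v v \<in> ?V" using idem Qc by auto
    fix w assume w: "w \<in> ?V"
    then have "(Q *\<^sub>v v) \<bullet> w = v \<bullet> w"
      using scalar_prod_symmetric_mat[OF Q v] by simp
    then show "(v - Q *\<^sub>v v) \<bullet> w = 0"
      using v w Qc by (simp add: minus_scalar_prod_distrib[where n = n])
  qed
  then show ?thesis
    using is_orthogonal_projection_unique[OF V _ is_orthogonal_projection_frame_proj[OF V us]] us(1) by blast
qed

lemma subspace_of_col_space:
  fixes A :: "real mat"
  assumes A: "A \<in> carrier_mat n nc"
  shows "subspace_of n (vec_space.col_space n A)"
proof -
  interpret vec_space "TYPE(real)" n .
  have eq: "col_space A = {A *\<^sub>v x |x. x \<in> carrier_vec nc}"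
    using A unfolding col_space_eq[OF A] by (auto intro: carrier_vecI)
  have "0\<^sub>v n = A *\<^sub>v 0\<^sub>v nc" using A by (intro eq_vecI) auto
  moreover have "\<exists>z. A *\<^sub>v x + A *\<^sub>v y = A *\<^sub>v z \<and> z \<in> carrier_vec nc"
    if "x \<in> carrier_vec nc" "y \<in> carrier_vec nc" for x y
    using that A by (intro exI[of _ "x + y"]) (auto simp: mult_add_distrib_mat_vec)
  moreover have "\<exists>z. c \<cdot>\<^sub>v (A *\<^sub>v x) = A *\<^sub>v z \<and> z \<in> carrier_vec nc"
    if "x \<in> carrier_vec nc" for x c
    using that A by (intro exI[of _ "c \<cdot>\<^sub>v x"]) (auto simp: mult_mat_vec)
  ultimately show ?thesis
    unfolding subspace_of_def eq using A by (auto intro: carrier_vecI)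
qed

text \<open>The columns are independent because \<open>U\<^sup>T U = I\<close>, and \<open>U\<close>
  has the same column space as \<open>U U\<^sup>T\<close>. This ties the matrix rank in
  \<open>model_rank\<close> to the trace.\<close>

lemma rank_frame_proj:
  assumes us: "orthonormal n us"
  shows "vec_space.rank n (frame_proj n us) = length us"
proof -
  interpret vec_space "TYPE(real)" n .
  let ?U = "mat_of_cols n us" and ?P = "frame_proj n us"
  have usc: "set us \<subseteq> carrier_vec n" using us by (simp add: orthonormal_def)
  have cols: "cols ?U = us" using usc by simp
  have U: "?U \<in> carrier_mat n (length us)" by simp
  have dist: "distinct (cols ?U)"
    unfolding cols distinct_conv_nth
  proof (intro allI impI)
    fix i j assume ij: "i < length us" "j < length us" "i \<noteq> j"
    then have "(us ! i) \<bullet> (us ! i) = 1" "(us ! i) \<bullet> (us ! j) = 0"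
      using us by (simp_all add: orthonormal_def)
    then show "us ! i \<noteq> us ! j" by auto
  qed
  have "lin_indpt (set (cols ?U))"
  proof (rule ccontr)
    assume "\<not> lin_indpt (set (cols ?U))"
    then obtain v where v: "v \<in> carrier_vec (length us)" "v \<noteq> 0\<^sub>v (length us)" "?U *\<^sub>v v = 0\<^sub>v n"
      using lin_depE[OF U _ dist] by auto
    have "?U\<^sup>T *\<^sub>v (?U *\<^sub>v v) = v"
      using v(1) orthonormal_gram[OF us]
        assoc_mult_mat_vec[of "?U\<^sup>T" "length us" n ?U "length us" v] by simp
    moreover have "?U\<^sup>T *\<^sub>v 0\<^sub>v n = 0\<^sub>v (length us)"
      by (intro eq_vecI) auto
    ultimately show False using v by simp
  qed
  then have "rank ?U = length us" by (rule lin_indpt_full_rank[OF U dist])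
  moreover have "col_space ?P = col_space ?U"
    unfolding col_space_eq[OF U] col_space_eq[OF frame_proj_carrier]
  proof (intro equalityI subsetI)
    fix y assume "y \<in> {y \<in> carrier_vec (dim_row ?P). \<exists>x\<in>carrier_vec (dim_col ?P). ?P *\<^sub>v x = y}"
    then obtain x where "x \<in> carrier_vec n" "y = ?P *\<^sub>v x"
      using frame_proj_carrier[of n us] by auto
    then show "y \<in> {y \<in> carrier_vec (dim_row ?U). \<exists>x\<in>carrier_vec (dim_col ?U). ?U *\<^sub>v x = y}"
      using frame_proj_alt[of x n us] by auto
  next
    fix y assume "y \<in> {y \<in> carrier_vec (dim_row ?U). \<exists>x\<in>carrier_vec (dim_col ?U). ?U *\<^sub>v x = y}"
    then obtain x where "x \<in> carrier_vec (length us)" "y = ?U *\<^sub>v x" by auto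
    then show "y \<in> {y \<in> carrier_vec (dim_row ?P). \<exists>x\<in>carrier_vec (dim_col ?P). ?P *\<^sub>v x = y}"
      using frame_proj_fixes_frame[OF us, of x] carrier_matD[OF frame_proj_carrier[of n us]]
      by (auto intro!: bexI[of _ "?U *\<^sub>v x"])
  qed
  ultimately show ?thesis
    unfolding rank_def col_space_def by simp
qed

section \<open>Projections of the candidate models\<close>

lemma design_matrix_carrier: "design_matrix S n k \<in> carrier_mat n (length (basis_funs S k))"
  by (simp add: design_matrix_def)

text \<open>Resolves the definite description in \<open>proj_mat\<close>; all later facts about
  \<open>M_k\<close> rest on these properties.\<close>

lemma proj_mat_frame:
  obtains us where "orthonormal n us" "proj_mat S n k = frame_proj n us" "length us = model_rank S n k"
    and "\<And>v. v \<in> carrier_vec n \<Longrightarrow> proj_mat S n k *\<^sub>v v \<in> vec_space.col_space n (design_matrix S n k)"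
    and "\<And>v. v \<in> vec_space.col_space n (design_matrix S n k) \<Longrightarrow> proj_mat S n k *\<^sub>v v = v"
proof -
  let ?V = "vec_space.col_space n (design_matrix S n k)"
  note V = subspace_of_col_space[OF design_matrix_carrier, of n S k]
  obtain us where us: "orthonormal n us" "set us \<subseteq> ?V" "\<And>v. v \<in> ?V \<Longrightarrow> frame_proj n us *\<^sub>v v = v"
    using exists_orthonormal_frame[OF V] by blast
  note P = is_orthogonal_projection_frame_proj[OF V us]
  have eq: "proj_mat S n k = frame_proj n us"
    unfolding proj_mat_def using is_orthogonal_projection_unique[OF V _ P] P by blast
  show thesis
  proof
    show "length us = model_rank S n k"
      unfolding model_rank_def eq rank_frame_proj[OF us(1)] ..
  qed (use us P in \<open>auto simp: eq is_orthogonal_projection_def\<close>)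
qed

lemma proj_mat_carrier [simp]: "proj_mat S n k \<in> carrier_mat n n"
  and transpose_proj_mat [simp]: "(proj_mat S n k)\<^sup>T = proj_mat S n k"
  and proj_mat_idem: "v \<in> carrier_vec n \<Longrightarrow> proj_mat S n k *\<^sub>v (proj_mat S n k *\<^sub>v v) = proj_mat S n k *\<^sub>v v"
  and trace_proj_mat: "(\<Sum>i<n. proj_mat S n k $$ (i, i)) = real (model_rank S n k)"
  by (rule proj_mat_frame[of n S k]; simp add: trace_frame_proj frame_proj_idem)+

lemma proj_mat_vec_carrier [simp]: "proj_mat S n k *\<^sub>v v \<in> carrier_vec n"
  by (rule carrier_vecI) (simp add: carrier_matD(1)[OF proj_mat_carrier])

text \<open>Sub-models are defined by inclusion of function families. Evaluating at the design
  points turns a linear combination of basis functions into one of columns.\<close>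

lemma family_column_space:
  assumes "family S k' \<subseteq> family S k"
  shows "vec_space.col_space n (design_matrix S n k') \<subseteq> vec_space.col_space n (design_matrix S n k)"
proof -
  interpret vec_space "TYPE(real)" n .
  have sub: "subspace_of n (col_space (design_matrix S n k))"
    by (rule subspace_of_col_space[OF design_matrix_carrier])
  have "v \<in> col_space (design_matrix S n k)" if v': "v \<in> set (cols (design_matrix S n k'))" for v
  proof -
    let ?bs = "basis_funs S k" and ?bs' = "basis_funs S k'"
    obtain j where j: "j < length ?bs'" and v: "v = col (design_matrix S n k') j"
      using v' carrier_matD(2)[OF design_matrix_carrier[of S n k']] by (auto simp: cols_def)
    have "?bs' ! j \<in> family S k'"
      unfolding family_def Let_def mem_Collect_eq
      \<comment> \<open>The coefficients are those of the \<open>j\<close>-th unit vector.\<close>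
      using j by (intro exI[of _ "\<lambda>i. if i = j then 1 else 0"]) (simp add: if_distrib[of "\<lambda>c. c * _"] cong: if_cong)
    then have "?bs' ! j \<in> family S k" using assms by blast
    then obtain \<theta> where \<theta>: "\<And>z. (?bs' ! j) z = (\<Sum>i<length ?bs. \<theta> i * (?bs ! i) z)"
      by (auto simp: family_def Let_def)
    have "v = design_matrix S n k *\<^sub>v vec (length ?bs) \<theta>"
      unfolding v using j
      by (intro eq_vecI) (auto simp: design_matrix_def scalar_prod_def \<theta> lessThan_atLeast0 mult.commute)
    then show ?thesis
      unfolding col_space_eq[OF design_matrix_carrier] using design_matrix_carrier[of S n k] by auto
  qed
  then have "set (cols (design_matrix S n k')) \<subseteq> col_space (design_matrix S n k)" by blast
  moreover have "mat_of_cols n (cols (design_matrix S n k')) = design_matrix S n k'"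
    using mat_of_cols_cols[of "design_matrix S n k'"] carrier_matD(1)[OF design_matrix_carrier[of S n k']] by simp
  ultimately have "design_matrix S n k' *\<^sub>v x \<in> col_space (design_matrix S n k)"
    if "x \<in> carrier_vec (length (basis_funs S k'))" for x
    using subspace_of_mat_of_cols[OF sub, of "cols (design_matrix S n k')" x] that design_matrix_carrier[of S n k'] by simp
  then show ?thesis
    unfolding col_space_eq[OF design_matrix_carrier[of S n k']] using design_matrix_carrier[of S n k'] by auto
qed

text \<open>The trace of \<open>I - M_k\<close> gives the degrees of freedom. The count is stated in
  the reals to avoid truncated subtraction.\<close>

lemma residual_frame:
  obtains vs where "orthonormal n vs" "1\<^sub>m n - proj_mat S n k = frame_proj n vs"
    "real (length vs) = real n - real (model_rank S n k)"
proof -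
  let ?P = "proj_mat S n k"
  let ?Q = "1\<^sub>m n - ?P"
  have Qv: "?Q *\<^sub>v v = v - ?P *\<^sub>v v" if "v \<in> carrier_vec n" for v
    using that by (simp add: minus_mult_distrib_mat_vec[of _ n n])
  have "?Q\<^sup>T = ?Q"
    by (simp add: transpose_minus[of _ n n])
  moreover have "?Q *\<^sub>v (?Q *\<^sub>v v) = ?Q *\<^sub>v v" if "v \<in> carrier_vec n" for v
    using that by (simp add: Qv mult_minus_distrib_mat_vec[of _ n n] proj_mat_idem vec_minus_minus_self[of _ n])
  moreover have Qc: "?Q \<in> carrier_mat n n" by (simp add: minus_carrier_mat)
  ultimately obtain vs where vs: "orthonormal n vs" "?Q = frame_proj n vs"
    using symmetric_idempotent_frame[of ?Q n] by blast
  have "real (length vs) = (\<Sum>i<n. ?Q $$ (i, i))"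
    unfolding vs(2) trace_frame_proj[OF vs(1)] ..
  also have "\<dots> = (\<Sum>i<n. 1 - ?P $$ (i, i))"
    using carrier_matD[OF proj_mat_carrier[of S n k]] by (intro sum.cong) auto
  also have "\<dots> = real n - real (model_rank S n k)"
    by (simp add: sum_subtractf trace_proj_mat)
  finally show thesis using vs that by blast
qed

text \<open>Nested column spaces make \<open>M_k - M_k'\<close> a projection, and the rank drop
  gives it trace 1. It therefore projects onto a single unit vector, and the residual sums of
  squares obey Pythagoras.\<close>

lemma submodel_frame:
  assumes k': "k' \<in> S1 S n k"
  obtains u where "u \<in> carrier_vec n" "sq_length u = 1"
    "\<And>v. v \<in> carrier_vec n \<Longrightarrow> sq_length ((proj_mat S n k - proj_mat S n k') *\<^sub>v v) = (u \<bullet> v)\<^sup>2"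
    "\<And>v. v \<in> carrier_vec n \<Longrightarrow> sq_length (v - proj_mat S n k' *\<^sub>v v) =
       sq_length (v - proj_mat S n k *\<^sub>v v) + sq_length ((proj_mat S n k - proj_mat S n k') *\<^sub>v v)"
proof -
  let ?P = "proj_mat S n k" and ?P' = "proj_mat S n k'"
  let ?D = "?P - ?P'"
  have fam: "family S k' \<subseteq> family S k" and rk: "model_rank S n k' + 1 = model_rank S n k"
    using k' by (auto simp: S1_def)
  have PP': "?P *\<^sub>v (?P' *\<^sub>v v) = ?P' *\<^sub>v v" if "v \<in> carrier_vec n" for v
    using family_column_space[OF fam, of n] that
    by (metis proj_mat_frame[of n S k] proj_mat_frame[of n S k'] subsetD)
  \<comment> \<open>The transpose of \<open>PP'\<close>, carried out by testing against all vectors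
    \<open>w\<close>.\<close>
  have P'P: "?P' *\<^sub>v (?P *\<^sub>v v) = ?P' *\<^sub>v v" if v: "v \<in> carrier_vec n" for v
  proof -
    have "(?P' *\<^sub>v (?P *\<^sub>v v)) \<bullet> w = (?P' *\<^sub>v v) \<bullet> w" if w: "w \<in> carrier_vec n" for w
      using v w by (simp add: scalar_prod_symmetric_mat[where n = n] PP')
    then have "(?P' *\<^sub>v (?P *\<^sub>v v)) $ i = (?P' *\<^sub>v v) $ i" if "i < n" for i
      using that proj_mat_vec_carrier scalar_prod_right_unit by (metis unit_vec_carrier)
    then show ?thesis
      by (intro eq_vecI) (simp_all add: carrier_matD(1)[OF proj_mat_carrier] del: index_mult_mat_vec)
  qed
  have Dv: "?D *\<^sub>v v = ?P *\<^sub>v v - ?P' *\<^sub>v v" if "v \<in> carrier_vec n" for v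
    using that by (simp add: minus_mult_distrib_mat_vec[of _ n n])
  have Dc: "?D \<in> carrier_mat n n" by (simp add: minus_carrier_mat)
  have Dt: "?D\<^sup>T = ?D" by (simp add: transpose_minus[of _ n n])
  have idem: "?D *\<^sub>v (?D *\<^sub>v v) = ?D *\<^sub>v v" if "v \<in> carrier_vec n" for v
    using that
    by (simp add: Dv mult_minus_distrib_mat_vec[of _ n n] proj_mat_idem PP' P'P vec_minus_minus_self[of _ n])
  obtain us where us: "orthonormal n us" "?D = frame_proj n us"
    using symmetric_idempotent_frame[OF Dc Dt idem] by blast
  have "real (length us) = (\<Sum>i<n. ?D $$ (i, i))"
    unfolding us(2) trace_frame_proj[OF us(1)] ..
  also have "\<dots> = (\<Sum>i<n. ?P $$ (i, i) - ?P' $$ (i, i))"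
    using carrier_matD[OF proj_mat_carrier[of S n k']] by (intro sum.cong) auto
  also have "\<dots> = 1"
    using rk by (simp add: sum_subtractf trace_proj_mat)
  finally have len: "length us = 1" by simp
  show thesis
  proof (rule that[of "us ! 0"])
    show "us ! 0 \<in> carrier_vec n" "sq_length (us ! 0) = 1"
      using us(1) len by (auto simp: orthonormal_def sq_length_def)
    fix v :: "real vec" assume v: "v \<in> carrier_vec n"
    show "sq_length (?D *\<^sub>v v) = ((us ! 0) \<bullet> v)\<^sup>2"
      unfolding us(2) sq_length_frame_proj[OF us(1) v] len by simp
    have D: "sq_length (?D *\<^sub>v v) = v \<bullet> (?D *\<^sub>v v)"
      unfolding sq_length_def using v Dc
      by (subst scalar_prod_symmetric_mat[OF Dc Dt]) (auto simp: idem intro: carrier_vecI)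
    have R: "sq_length (v - proj_mat S n l *\<^sub>v v) = v \<bullet> v - v \<bullet> (proj_mat S n l *\<^sub>v v)" for l
      unfolding sq_length_def using v 
      by (simp add: minus_scalar_prod_distrib[where n = n] scalar_prod_minus_distrib[where n = n]
           scalar_prod_symmetric_mat[where n = n] proj_mat_idem)
    show "sq_length (v - ?P' *\<^sub>v v) = sq_length (v - ?P *\<^sub>v v) + sq_length (?D *\<^sub>v v)"
      unfolding D R unfolding Dv[OF v] using v by (simp add: scalar_prod_minus_distrib[where n = n])
  qed
qed

section \<open>Tail bounds for the errors of a model\<close>

lemma residual_carrier [simp]: "1\<^sub>m n - proj_mat S n k \<in> carrier_mat n n"
  by (simp add: minus_carrier_mat)

lemma residual_vec_carrier [simp]: "(1\<^sub>m n - proj_mat S n k) *\<^sub>v v \<in> carrier_vec n"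
  by (rule carrier_vecI) (simp add: carrier_matD(1)[OF proj_mat_carrier])

lemma residual_mult_vec:
  "v \<in> carrier_vec n \<Longrightarrow> (1\<^sub>m n - proj_mat S n k) *\<^sub>v v = v - proj_mat S n k *\<^sub>v v"
  by (simp add: minus_mult_distrib_mat_vec[of _ n n])

context gaussian_noise
begin

definition noise :: "nat \<Rightarrow> 'w \<Rightarrow> real vec" where
  "noise n \<omega> = vec n (\<lambda>i. \<epsilon> i \<omega>)"

lemma noise_carrier [simp]: "noise n \<omega> \<in> carrier_vec n"
  by (simp add: noise_def)

lemma scalar_prod_noise: "u \<bullet> noise n \<omega> = (\<Sum>i<n. u $ i * \<epsilon> i \<omega>)"
  by (simp add: noise_def scalar_prod_def lessThan_atLeast0)

lemma measurable_scalar_prod_noise [measurable]: "(\<lambda>\<omega>. u \<bullet> noise n \<omega>) \<in> borel_measurable M"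
  unfolding scalar_prod_noise by measurable

lemma measurable_sq_length_noise [measurable]:
  "(\<lambda>\<omega>. sq_length (A *\<^sub>v noise n \<omega>)) \<in> borel_measurable M"
proof -
  have "(\<lambda>\<omega>. sq_length (A *\<^sub>v noise n \<omega>)) = (\<lambda>\<omega>. \<Sum>i<dim_row A. (row A i \<bullet> noise n \<omega>) * (row A i \<bullet> noise n \<omega>))"
    by (rule ext) (simp add: sq_length_def scalar_prod_def[of "_ *\<^sub>v _"] lessThan_atLeast0)
  then show ?thesis by simp
qed

lemma residual_noise_tail:
  assumes j: "model_rank S n k < n" and t: "t \<ge> 0"
  shows "measure M {\<omega> \<in> space M. sq_length ((1\<^sub>m n - proj_mat S n k) *\<^sub>v noise n \<omega>)
      \<le> \<sigma>\<^sup>2 * (real n - real (model_rank S n k) - t)}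
    \<le> exp (- (t\<^sup>2 / (4 * (real n - real (model_rank S n k)))))"
proof -
  obtain vs where vs: "orthonormal n vs" "1\<^sub>m n - proj_mat S n k = frame_proj n vs"
    and len: "real (length vs) = real n - real (model_rank S n k)"
    by (rule residual_frame)
  have orth: "(\<Sum>i<n. vs ! l $ i * vs ! l' $ i) = (if l = l' then 1 else 0)"
    if "l < length vs" "l' < length vs" for l l'
  proof -
    have "vs ! l' \<in> carrier_vec n" using vs(1) that by (auto simp: orthonormal_def)
    then have "(vs ! l) \<bullet> (vs ! l') = (\<Sum>i<n. vs ! l $ i * vs ! l' $ i)"
      by (simp add: scalar_prod_def lessThan_atLeast0)
    then show ?thesis using vs(1) that by (simp add: orthonormal_def)
  qed
  have "length vs > 0" using j len by linarith
  from chi_square_lower_tail[where u = "\<lambda>l i. vs ! l $ i", OF orth this t]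
  show ?thesis
    unfolding vs(2) sq_length_frame_proj[OF vs(1) noise_carrier] scalar_prod_noise len .
qed

lemma submodel_noise_tail:
  assumes k': "k' \<in> S1 S n k" and t: "t \<ge> 0"
  shows "measure M {\<omega> \<in> space M. sq_length ((proj_mat S n k - proj_mat S n k') *\<^sub>v noise n \<omega>) \<ge> \<sigma>\<^sup>2 * t}
    \<le> 2 * exp (- t / 2)"
proof -
  obtain u where u: "u \<in> carrier_vec n" "sq_length u = 1"
    and eq: "\<And>v. v \<in> carrier_vec n \<Longrightarrow> sq_length ((proj_mat S n k - proj_mat S n k') *\<^sub>v v) = (u \<bullet> v)\<^sup>2"
    by (rule submodel_frame[OF k']) blast
  show ?thesis
    unfolding eq[OF noise_carrier] scalar_prod_noise
    by (rule noise_square_tail) (use u t in \<open>simp_all add: sq_length_eq_sum\<close>)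
qed

lemma cross_noise_tail:
  assumes "w \<in> carrier_vec n" "sq_length w \<le> \<sigma>\<^sup>2 * c" "\<eta> \<ge> 0"
  shows "measure M {\<omega> \<in> space M. 2 * (w \<bullet> noise n \<omega>) \<le> - (\<eta> * \<sigma>\<^sup>2 * c)} \<le> exp (- (\<eta>\<^sup>2 * c / 8))"
  unfolding scalar_prod_noise using assms by (intro noise_tail_quadratic) (simp_all add: sq_length_eq_sum)

lemma observations_eq: "observations S \<epsilon> g n \<omega> = signal S g n + noise n \<omega>"
  by (rule eq_vecI) (auto simp: observations_def signal_def noise_def)

text \<open>Expand the squared residual of signal plus noise; the residual matrix is symmetric and
  idempotent, so the cross term is linear in the noise. Centring the chi-square term by its mean
  \<open>\<sigma>\<^sup>2 * (n - r_k)\<close> accounts for the \<open>- 1\<close> in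
  \<open>complexity\<close>.\<close>

lemma IC_observations:
  "IC S \<sigma> l d n (observations S \<epsilon> g n \<omega>) k = \<sigma>\<^sup>2 * complexity S g \<sigma> l d n k
     + (sq_length ((1\<^sub>m n - proj_mat S n k) *\<^sub>v noise n \<omega>) - \<sigma>\<^sup>2 * (real n - real (model_rank S n k)))
     + 2 * (((1\<^sub>m n - proj_mat S n k) *\<^sub>v signal S g n) \<bullet> noise n \<omega>)"
proof -
  let ?Q = "1\<^sub>m n - proj_mat S n k" and ?f = "signal S g n" and ?e = "noise n \<omega>"
  have f: "?f \<in> carrier_vec n" by (simp add: signal_def)
  have Qt: "?Q\<^sup>T = ?Q" by (simp add: transpose_minus[of _ n n])
  have "?Q *\<^sub>v (?Q *\<^sub>v ?f) = ?Q *\<^sub>v ?f"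
    using f by (simp add: residual_mult_vec mult_minus_distrib_mat_vec[of _ n n] proj_mat_idem
        vec_minus_minus_self[of _ n])
  then have QQ: "(?Q *\<^sub>v ?f) \<bullet> (?Q *\<^sub>v ?e) = (?Q *\<^sub>v ?f) \<bullet> ?e"
    using scalar_prod_symmetric_mat[OF residual_carrier Qt residual_vec_carrier noise_carrier, of S k ?f \<omega>] by simp
  have "(?f + ?e) - proj_mat S n k *\<^sub>v (?f + ?e) = ?Q *\<^sub>v (?f + ?e)"
    using f by (simp add: residual_mult_vec)
  also have "\<dots> = ?Q *\<^sub>v ?f + ?Q *\<^sub>v ?e"
    using f by (simp only: mult_add_distrib_mat_vec[OF residual_carrier] noise_carrier)
  finally have "sq_length ((?f + ?e) - proj_mat S n k *\<^sub>v (?f + ?e)) = sq_length (?Q *\<^sub>v ?f + ?Q *\<^sub>v ?e)"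
    by simp
  also have "\<dots> = sq_length (?Q *\<^sub>v ?f) + 2 * ((?Q *\<^sub>v ?f) \<bullet> ?e) + sq_length (?Q *\<^sub>v ?e)"
    unfolding sq_length_def QQ[symmetric]
    by (simp add: scalar_prod_add_distrib[of _ n] add_scalar_prod_distrib[of _ n]
        comm_scalar_prod[of "?Q *\<^sub>v ?e" n "?Q *\<^sub>v ?f"])
  finally show ?thesis
    using sigma by (simp add: IC_def complexity_def observations_eq field_simps)
qed

end

text \<open>The lower bound on the penalty makes all three summands of \<open>complexity\<close>
  nonnegative, so each is bounded by the whole.\<close>

lemma complexity_bounds:
  assumes n: "n \<ge> 2" and l: "l \<ge> inverse (ln (real n))" and d: "d \<ge> 0" and \<sigma>: "\<sigma> > 0"
  shows "1 \<le> l * ln (real n)"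
    and "0 \<le> complexity S g \<sigma> l d n k"
    and "(l * ln (real n) - 1) * real (model_rank S n k) \<le> complexity S g \<sigma> l d n k"
    and "sq_length ((1\<^sub>m n - proj_mat S n k) *\<^sub>v signal S g n) \<le> \<sigma>\<^sup>2 * complexity S g \<sigma> l d n k"
proof -
  have ln: "ln (real n) > 0" using n by simp
  show l1: "1 \<le> l * ln (real n)"
    using mult_right_mono[OF l less_imp_le[OF ln]] ln by simp
  have 1: "(l * ln (real n) - 1) * real (model_rank S n k) \<ge> 0" using l1 by simp
  have 2: "d * sqrt (real n) * ln (real n) \<ge> 0" using d ln by simp
  have 3: "sq_length ((1\<^sub>m n - proj_mat S n k) *\<^sub>v signal S g n) / \<sigma>\<^sup>2 \<ge> 0"
    using sq_length_nonneg by simp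
  show "0 \<le> complexity S g \<sigma> l d n k"
    "(l * ln (real n) - 1) * real (model_rank S n k) \<le> complexity S g \<sigma> l d n k"
    unfolding complexity_def using 1 2 3 by linarith+
  have "sq_length ((1\<^sub>m n - proj_mat S n k) *\<^sub>v signal S g n) / \<sigma>\<^sup>2 \<le> complexity S g \<sigma> l d n k"
    unfolding complexity_def using 1 2 3 by linarith
  then show "sq_length ((1\<^sub>m n - proj_mat S n k) *\<^sub>v signal S g n) \<le> \<sigma>\<^sup>2 * complexity S g \<sigma> l d n k"
    using \<sigma> by (simp add: pos_divide_le_eq mult.commute)
qed

lemma sq_length_add_le:
  assumes "v \<in> carrier_vec n" "w \<in> carrier_vec n"
  shows "sq_length (v + w) \<le> 2 * sq_length v + 2 * sq_length w"
proof -
  have "sq_length (v + w) = (\<Sum>i<n. (v $ i + w $ i)\<^sup>2)"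
    using assms by (simp add: sq_length_def scalar_prod_def power2_eq_square lessThan_atLeast0)
  also have "\<dots> \<le> (\<Sum>i<n. 2 * (v $ i)\<^sup>2 + 2 * (w $ i)\<^sup>2)"
  proof (rule sum_mono)
    fix i show "(v $ i + w $ i)\<^sup>2 \<le> 2 * (v $ i)\<^sup>2 + 2 * (w $ i)\<^sup>2"
      using sum_squares_bound[of "v $ i" "w $ i"] by (simp add: power2_sum)
  qed
  also have "\<dots> = 2 * sq_length v + 2 * sq_length w"
    using assms by (simp add: sq_length_def scalar_prod_def power2_eq_square lessThan_atLeast0
        sum.distrib sum_distrib_left)
  finally show ?thesis .
qed

text \<open>Every ratio is 1 plus a squared projection minus the penalty for one parameter, over
  \<open>IC\<close> of \<open>k\<close>. A small penalty bounds all ratios from below; from above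
  one good \<open>k'\<close> suffices, as the index is an infimum.\<close>

lemma PI_close_to_1:
  assumes \<sigma>: "\<sigma> > 0" and e: "e > 0" and c: "c > 0"
    and rank: "model_rank S n k > 1" and ne: "S1 S n k \<noteq> {}"
    and y: "y \<in> carrier_vec n"
    and IC: "IC S \<sigma> l d n y k \<ge> \<sigma>\<^sup>2 * c / 20"
    and l: "0 \<le> l * ln (real n)" "l * ln (real n) \<le> e * c / 20"
    and k': "k' \<in> S1 S n k" "sq_length ((proj_mat S n k - proj_mat S n k') *\<^sub>v y) \<le> e * \<sigma>\<^sup>2 * c / 20"
  shows "\<bar>PI S \<sigma> l d n y k - 1\<bar> \<le> e"
proof -
  let ?I = "IC S \<sigma> l d n y k"
  let ?L = "l * ln (real n) * \<sigma>\<^sup>2"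
  have pos: "?I > 0" using IC c \<sigma> by (smt (verit) divide_pos_pos mult_pos_pos zero_less_power)
  have eI: "e * \<sigma>\<^sup>2 * c / 20 \<le> e * ?I"
    using mult_left_mono[OF IC less_imp_le[OF e]] by (simp add: mult.assoc)
  have ratio: "IC S \<sigma> l d n y q / ?I
      = 1 + (sq_length ((proj_mat S n k - proj_mat S n q) *\<^sub>v y) - ?L) / ?I" if q: "q \<in> S1 S n k" for q
  proof -
    have rk: "real (model_rank S n k) = real (model_rank S n q) + 1"
      using q by (auto simp: S1_def)
    have "sq_length (y - proj_mat S n q *\<^sub>v y) =
       sq_length (y - proj_mat S n k *\<^sub>v y) + sq_length ((proj_mat S n k - proj_mat S n q) *\<^sub>v y)"
      by (rule submodel_frame[OF q]) (use y in blast)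
    then have "IC S \<sigma> l d n y q = ?I + (sq_length ((proj_mat S n k - proj_mat S n q) *\<^sub>v y) - ?L)"
      by (simp add: IC_def rk algebra_simps)
    then show ?thesis using pos by (simp add: field_simps)
  qed
  have "?L \<le> e * ?I"
    using mult_right_mono[OF l(2), of "\<sigma>\<^sup>2"] eI by (simp add: mult_ac)
  then have lower: "1 - e \<le> IC S \<sigma> l d n y q / ?I" if q: "q \<in> S1 S n k" for q
    unfolding ratio[OF q] using pos sq_length_nonneg[of "(proj_mat S n k - proj_mat S n q) *\<^sub>v y"]
    by (simp add: field_simps)
  have PI: "PI S \<sigma> l d n y k = (INF q \<in> S1 S n k. IC S \<sigma> l d n y q / ?I)"
    using rank by (simp add: PI_def)
  have "1 - e \<le> PI S \<sigma> l d n y k"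
    unfolding PI using ne lower by (intro cINF_greatest) auto
  \<comment> \<open>An infimum of reals lies below its members only if the set is bounded below;
    \<open>1 - e\<close> is such a bound.\<close>
  moreover have "PI S \<sigma> l d n y k \<le> IC S \<sigma> l d n y k' / ?I"
    unfolding PI using lower by (intro cINF_lower k'(1) bdd_belowI2[of _ "1 - e"]) auto
  moreover have "IC S \<sigma> l d n y k' / ?I \<le> 1 + e"
  proof -
    have "?L \<ge> 0" using l(1) by simp
    then have "sq_length ((proj_mat S n k - proj_mat S n k') *\<^sub>v y) - ?L \<le> e * ?I"
      using k'(2) eI by linarith
    then show ?thesis unfolding ratio[OF k'(1)] using pos by (simp add: field_simps)
  qed
  ultimately show ?thesis by linarith
qed

section \<open>Simultaneous control of all candidates\<close>

context gaussian_noise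
begin

text \<open>Union bound over all candidates with rank in \<open>J\<close>, where
  \<open>\<beta> j\<close> is the finite value of \<open>B_{j,n}\<close>. One event serves all
  models at once, as needed for a data-dependent selection.\<close>

lemma exceptional_event:
  fixes S :: "('k, 'p::finite) candidates" and \<beta> :: "nat \<Rightarrow> real"
  assumes J: "finite J" "\<And>j. j \<in> J \<Longrightarrow> j < n"
    and \<beta>: "\<And>j. j \<in> J \<Longrightarrow> 0 \<le> \<beta> j"
    and fin: "\<And>j. j \<in> J \<Longrightarrow> finite (models_of_rank S n j)"
    and N: "\<And>j. j \<in> J \<Longrightarrow> real (card (models_of_rank S n j)) \<le> c0 * exp ((\<beta> j)\<^sup>2 / (10 * (real n - real j)))"
    and fin1: "\<And>j k. j \<in> J \<Longrightarrow> k \<in> models_of_rank S n j \<Longrightarrow> finite (S1 S n k)"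
    and NL: "\<And>j. j \<in> J \<Longrightarrow> (\<Sum>k\<in>models_of_rank S n j. real (card (S1 S n k))) \<le> c0 * exp (z * \<beta> j)"
    and comp: "\<And>j k. j \<in> J \<Longrightarrow> k \<in> models_of_rank S n j \<Longrightarrow> \<beta> j \<le> complexity S g \<sigma> l d n k"
    and bias: "\<And>j k. j \<in> J \<Longrightarrow> k \<in> models_of_rank S n j \<Longrightarrow>
       sq_length ((1\<^sub>m n - proj_mat S n k) *\<^sub>v signal S g n) \<le> \<sigma>\<^sup>2 * complexity S g \<sigma> l d n k"
    and small: "\<And>j. j \<in> J \<Longrightarrow> \<beta> j / (10 * (real n - real j)) \<le> \<tau>"
    and \<tau>: "\<tau> \<le> 1 / 6400" "\<tau> \<le> \<delta> / 4" and z: "z \<le> \<delta> / 4" and \<delta>: "\<delta> > 0" and c0: "c0 > 0"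
  obtains E where "E \<in> sets M"
    and "measure M E \<le> 4 * c0 * (\<Sum>j\<in>J. exp (- ((\<beta> j)\<^sup>2 / (10 * (real n - real j)))))"
    and "\<And>\<omega> k. \<omega> \<in> space M - E \<Longrightarrow> model_rank S n k \<in> J \<Longrightarrow> k \<in> cand S n \<Longrightarrow>
          \<sigma>\<^sup>2 * complexity S g \<sigma> l d n k / 20 \<le> IC S \<sigma> l d n (observations S \<epsilon> g n \<omega>) k"
    and "\<And>\<omega> k k'. \<omega> \<in> space M - E \<Longrightarrow> model_rank S n k \<in> J \<Longrightarrow> k \<in> cand S n \<Longrightarrow> k' \<in> S1 S n k \<Longrightarrow>
          sq_length ((proj_mat S n k - proj_mat S n k') *\<^sub>v noise n \<omega>) \<le> \<delta> * \<sigma>\<^sup>2 * complexity S g \<sigma> l d n k"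
proof -
  let ?K = "models_of_rank S n" and ?c = "complexity S g \<sigma> l d n"
  let ?Q = "\<lambda>k. 1\<^sub>m n - proj_mat S n k"
  define A where "A j k = {\<omega> \<in> space M. sq_length (?Q k *\<^sub>v noise n \<omega>)
      \<le> \<sigma>\<^sup>2 * (real n - real (model_rank S n k) - 9 / 10 * \<beta> j)}" for j k
  \<comment> \<open>The threshold involves \<open>?c k\<close> rather than \<open>\<beta> j\<close>,
    because the variance of the cross term grows with \<open>?c k\<close>.\<close>
  define C where "C k = {\<omega> \<in> space M. 2 * ((?Q k *\<^sub>v signal S g n) \<bullet> noise n \<omega>) \<le> - (1 / 20 * \<sigma>\<^sup>2 * ?c k)}" for k
  define D where "D j k k' = {\<omega> \<in> space M. sq_length ((proj_mat S n k - proj_mat S n k') *\<^sub>v noise n \<omega>)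
      \<ge> \<sigma>\<^sup>2 * (\<delta> * \<beta> j)}" for j k k'
  define x where "x j = (\<beta> j)\<^sup>2 / (10 * (real n - real j))" for j
  define F where "F j k = A j k \<union> C k \<union> (\<Union>k'\<in>S1 S n k. D j k k')" for j k
  define E where "E = (\<Union>j\<in>J. \<Union>k\<in>?K j. F j k)"
  have ADC [measurable]: "A j k \<in> sets M" "C k \<in> sets M" "D j k k' \<in> sets M" for j k k'
    unfolding A_def C_def D_def by measurable
  have F_sets [measurable]: "F j k \<in> sets M" if "j \<in> J" "k \<in> ?K j" for j k
    unfolding F_def using fin1[OF that] by (intro sets.Un sets.finite_UN ADC)
  have x\<beta>: "x j \<le> \<tau> * \<beta> j" if "j \<in> J" for j
    using mult_right_mono[OF small[OF that] \<beta>[OF that]] by (simp add: x_def power2_eq_square)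
  have x6400: "2 * x j \<le> \<beta> j / 3200" and x\<delta>: "x j \<le> \<delta> * \<beta> j / 4" if "j \<in> J" for j
    using x\<beta>[OF that] mult_right_mono[OF \<tau>(1) \<beta>[OF that]] mult_right_mono[OF \<tau>(2) \<beta>[OF that]] by auto
  have F: "measure M (F j k) \<le> 2 * exp (- 2 * x j) + 2 * real (card (S1 S n k)) * exp (- \<delta> * \<beta> j / 2)"
    if j: "j \<in> J" and k: "k \<in> ?K j" for j k
  proof -
    have rk: "model_rank S n k = j" using k by (simp add: models_of_rank_def)
    have m: "real n - real j > 0" using J(2)[OF j] by simp
    have "measure M (A j k) \<le> exp (- ((9 / 10 * \<beta> j)\<^sup>2 / (4 * (real n - real j))))"
      using residual_noise_tail[of S n k "9 / 10 * \<beta> j"] rk J(2)[OF j] \<beta>[OF j] unfolding A_def by simp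
    \<comment> \<open>Since \<open>0.81 / 4 > 2 / 10\<close>, the exponent is at least
      \<open>2 * x j\<close>. One half of it will pay for the number of models of rank
      \<open>j\<close>.\<close>
    also have "\<dots> \<le> exp (- 2 * x j)"
      using m mult_right_mono[of "real j" "real n" "\<beta> j * \<beta> j"]
      unfolding x_def exp_le_cancel_iff by (simp add: field_simps power2_eq_square)
    finally have mA: "measure M (A j k) \<le> exp (- 2 * x j)" .
    have "measure M (C k) \<le> exp (- ((1 / 20)\<^sup>2 * ?c k / 8))"
      unfolding C_def by (rule cross_noise_tail) (use bias[OF j k] in auto)
    \<comment> \<open>Here \<open>(1/20)^2 / 8 = 1/3200\<close>, which is the reason for the bound
      \<open>\<tau> \<le> 1 / 6400\<close>.\<close>
    also have "\<dots> \<le> exp (- 2 * x j)"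
      using x6400[OF j] comp[OF j k] by (simp add: power2_eq_square)
    finally have mC: "measure M (C k) \<le> exp (- 2 * x j)" .
    have mD: "measure M (D j k k') \<le> 2 * exp (- \<delta> * \<beta> j / 2)" if "k' \<in> S1 S n k" for k'
      using submodel_noise_tail[OF that, of "\<delta> * \<beta> j"] \<delta> \<beta>[OF j] unfolding D_def by simp
    have "measure M (F j k) \<le> measure M (A j k \<union> C k) + measure M (\<Union>k'\<in>S1 S n k. D j k k')"
      unfolding F_def using fin1[OF j k] by (intro measure_Un_le sets.Un sets.finite_UN ADC)
    also have "\<dots> \<le> (measure M (A j k) + measure M (C k)) + (\<Sum>k'\<in>S1 S n k. measure M (D j k k'))"
      using fin1[OF j k] by (intro add_mono measure_Un_le measure_UNION_le ADC)
    also have "\<dots> \<le> (exp (- 2 * x j) + exp (- 2 * x j)) + (\<Sum>k'\<in>S1 S n k. 2 * exp (- \<delta> * \<beta> j / 2))"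
      by (intro add_mono sum_mono mA mC mD)
    finally show ?thesis by simp
  qed
  have "measure M E \<le> (\<Sum>j\<in>J. measure M (\<Union>k\<in>?K j. F j k))"
    unfolding E_def using J(1) fin by (intro measure_UNION_le sets.finite_UN F_sets)
  also have "\<dots> \<le> (\<Sum>j\<in>J. \<Sum>k\<in>?K j. measure M (F j k))"
    using fin by (intro sum_mono measure_UNION_le F_sets)
  also have "\<dots> \<le> (\<Sum>j\<in>J. \<Sum>k\<in>?K j. 2 * exp (- 2 * x j) + 2 * real (card (S1 S n k)) * exp (- \<delta> * \<beta> j / 2))"
    by (intro sum_mono F)
  also have "\<dots> \<le> (\<Sum>j\<in>J. 4 * c0 * exp (- x j))"
  proof (rule sum_mono)
    fix j assume j: "j \<in> J"
    have "(\<Sum>k\<in>?K j. 2 * exp (- 2 * x j) + 2 * real (card (S1 S n k)) * exp (- \<delta> * \<beta> j / 2))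
        = 2 * real (card (?K j)) * exp (- 2 * x j) + 2 * (\<Sum>k\<in>?K j. real (card (S1 S n k))) * exp (- \<delta> * \<beta> j / 2)"
      by (simp add: sum.distrib sum_distrib_left sum_distrib_right)
    also have "\<dots> \<le> 2 * (c0 * exp (x j)) * exp (- 2 * x j) + 2 * (c0 * exp (z * \<beta> j)) * exp (- \<delta> * \<beta> j / 2)"
      using N[OF j] NL[OF j] unfolding x_def by (intro add_mono mult_right_mono mult_left_mono) auto
    also have "\<dots> = 2 * c0 * exp (x j + - 2 * x j) + 2 * c0 * exp (z * \<beta> j + - \<delta> * \<beta> j / 2)"
      unfolding exp_add by simp
    \<comment> \<open>In the second exponent, \<open>z \<le> \<delta> / 4\<close> leaves at most
      \<open>- \<delta> * \<beta> j / 4\<close>, which \<open>x\<delta>\<close> bounds by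
      \<open>- x j\<close>.\<close>
    also have "\<dots> \<le> 2 * c0 * exp (- x j) + 2 * c0 * exp (- x j)"
      using x\<delta>[OF j] mult_right_mono[OF z \<beta>[OF j]] c0 by (intro add_mono mult_left_mono) auto
    finally show "(\<Sum>k\<in>?K j. 2 * exp (- 2 * x j) + 2 * real (card (S1 S n k)) * exp (- \<delta> * \<beta> j / 2))
        \<le> 4 * c0 * exp (- x j)" by simp
  qed
  finally have mE: "measure M E \<le> 4 * c0 * (\<Sum>j\<in>J. exp (- ((\<beta> j)\<^sup>2 / (10 * (real n - real j)))))"
    by (simp add: sum_distrib_left x_def)
  show thesis
  proof (rule that[OF _ mE])
    show "E \<in> sets M" unfolding E_def using J(1) fin by (intro sets.finite_UN F_sets)
  next
    fix \<omega> k assume \<omega>: "\<omega> \<in> space M - E" and jk: "model_rank S n k \<in> J" "k \<in> cand S n"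
    define j where "j = model_rank S n k"
    have j: "j \<in> J" and k: "k \<in> ?K j" using jk by (auto simp: j_def models_of_rank_def)
    have notF: "\<omega> \<notin> F j k" using \<omega> j k by (auto simp: E_def)
    have "sq_length (?Q k *\<^sub>v noise n \<omega>) > \<sigma>\<^sup>2 * (real n - real (model_rank S n k) - 9 / 10 * \<beta> j)"
      "2 * ((?Q k *\<^sub>v signal S g n) \<bullet> noise n \<omega>) > - (1 / 20 * \<sigma>\<^sup>2 * ?c k)"
      using notF \<omega> by (auto simp: F_def A_def C_def)
    moreover have "\<sigma>\<^sup>2 * \<beta> j \<le> \<sigma>\<^sup>2 * ?c k"
      using comp[OF j k] by (simp add: mult_left_mono)
    \<comment> \<open>The chi-square term costs at most 9/10 of
      \<open>\<sigma>\<^sup>2 * ?c k\<close> and the cross term 1/20, which leaves 1/20.\<close>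
    ultimately show "\<sigma>\<^sup>2 * ?c k / 20 \<le> IC S \<sigma> l d n (observations S \<epsilon> g n \<omega>) k"
      unfolding IC_observations by (simp add: algebra_simps)
    fix k' assume k': "k' \<in> S1 S n k"
    have "sq_length ((proj_mat S n k - proj_mat S n k') *\<^sub>v noise n \<omega>) < \<sigma>\<^sup>2 * (\<delta> * \<beta> j)"
      using notF \<omega> k' by (auto simp: F_def D_def)
    also have "\<dots> \<le> \<sigma>\<^sup>2 * (\<delta> * ?c k)"
      using comp[OF j k] \<delta> by (intro mult_left_mono) auto
    finally show "sq_length ((proj_mat S n k - proj_mat S n k') *\<^sub>v noise n \<omega>) \<le> \<delta> * \<sigma>\<^sup>2 * ?c k"
      by (simp add: mult_ac)
  qed
qed

end

section \<open>The selected model\<close>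

lemma ecard_le_ereal:
  assumes "ecard A \<le> ereal r"
  shows "finite A" "real (card A) \<le> r"
  using assms by (cases "finite A"; simp add: ecard_def)+

lemma ecard_nonneg: "0 \<le> ecard A"
  by (simp add: ecard_def)

text \<open>Passes from extended to ordinary reals: the bound on the quotient makes \<open>B\<close>
  finite, and then the counting conditions make all collections of rank \<open>j\<close>
  finite.\<close>

lemma finite_model_data:
  fixes S :: "('k, 'p::finite) candidates"
  assumes n: "n \<ge> 2" and l: "l \<ge> inverse (ln (real n))" and d: "d \<ge> 0" and \<sigma>: "\<sigma> > 0"
    and j: "j < n"
    and B: "B S g \<sigma> l d n j / ereal (real n - real j) < ereal (10 * \<tau>)"
    and NL: "num_models S n j * max_submodels S n j \<le> ereal c0 * exp_ereal (ereal z * B S g \<sigma> l d n j)"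
    and N: "num_models S n j \<le> ereal c0 * exp_ereal ((B S g \<sigma> l d n j)\<^sup>2 / ereal (10 * (real n - real j)))"
  obtains \<beta> where "B S g \<sigma> l d n j = ereal \<beta>" "0 \<le> \<beta>" "\<beta> / (10 * (real n - real j)) \<le> \<tau>"
    "finite (models_of_rank S n j)"
    "real (card (models_of_rank S n j)) \<le> c0 * exp (\<beta>\<^sup>2 / (10 * (real n - real j)))"
    "\<And>k. k \<in> models_of_rank S n j \<Longrightarrow> finite (S1 S n k)"
    "(\<Sum>k\<in>models_of_rank S n j. real (card (S1 S n k))) \<le> c0 * exp (z * \<beta>)"
    "\<And>k. k \<in> models_of_rank S n j \<Longrightarrow> \<beta> \<le> complexity S g \<sigma> l d n k"
proof -
  let ?K = "models_of_rank S n j" and ?B = "B S g \<sigma> l d n j"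
  have m: "real n - real j > 0" using j by simp
  have "0 \<le> ?B"
    unfolding B_def using complexity_bounds(2)[OF n l d \<sigma>] by (intro INF_greatest) simp
  moreover have "?B \<noteq> \<infinity>" using B m by auto
  ultimately obtain \<beta> where \<beta>: "?B = ereal \<beta>" "0 \<le> \<beta>" by (cases ?B) auto
  have \<beta>m: "\<beta> / (10 * (real n - real j)) \<le> \<tau>"
    using B m unfolding \<beta>(1) by (simp add: field_simps)
  have cN: "ecard ?K \<le> ereal (c0 * exp (\<beta>\<^sup>2 / (10 * (real n - real j))))"
    using N m unfolding num_models_def \<beta>(1) by (simp add: power2_eq_square exp_ereal_def)
  \<comment> \<open>An infimum over no models would be infinite.\<close>
  have K: "?K \<noteq> {}"
    using \<beta>(1) by (auto simp: B_def top_ereal_def)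
  have fin: "finite ?K" by (rule ecard_le_ereal(1)[OF cN])
  have NK: "num_models S n j = ereal (real (card ?K))" and pos: "card ?K \<ge> 1"
    using fin K by (auto simp: num_models_def ecard_def Suc_le_eq card_gt_0_iff)
  have up: "ecard (S1 S n k) \<le> max_submodels S n j" if "k \<in> ?K" for k
    unfolding max_submodels_def using that by (rule SUP_upper)
  obtain k0 where "k0 \<in> ?K" using K by blast
  then have max0: "0 \<le> max_submodels S n j"
    using up ecard_nonneg order_trans by blast
  have NL': "ereal (real (card ?K)) * max_submodels S n j \<le> ereal (c0 * exp (z * \<beta>))"
    using NL unfolding NK \<beta>(1) by (simp add: exp_ereal_def)
  \<comment> \<open>With at least one model of rank \<open>j\<close>, an infinite maximum would make
    the product infinite.\<close>
  then have "max_submodels S n j \<noteq> \<infinity>"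
    using pos by auto
  with max0 obtain L where L: "max_submodels S n j = ereal L" by (cases "max_submodels S n j") auto
  have S1: "finite (S1 S n k)" "real (card (S1 S n k)) \<le> L" if "k \<in> ?K" for k
    using ecard_le_ereal[of "S1 S n k" L] up[OF that] unfolding L by auto
  \<comment> \<open>The product of the two counts dominates the number of pairs of a model and a
    sub-model, over which the union bound runs.\<close>
  have "(\<Sum>k\<in>?K. real (card (S1 S n k))) \<le> (\<Sum>k\<in>?K. L)"
    by (intro sum_mono S1)
  also have "\<dots> \<le> c0 * exp (z * \<beta>)"
    using NL' unfolding L by simp
  finally have sum: "(\<Sum>k\<in>?K. real (card (S1 S n k))) \<le> c0 * exp (z * \<beta>)" .
  have comp: "\<beta> \<le> complexity S g \<sigma> l d n k" if "k \<in> ?K" for k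
    using INF_lower[OF that, of "\<lambda>k. ereal (complexity S g \<sigma> l d n k)"] \<beta>(1) by (simp add: B_def)
  show thesis
    by (rule that[OF \<beta> \<beta>m fin ecard_le_ereal(2)[OF cN] S1(1) sum comp])
qed

section \<open>Probability bound at a fixed sample size\<close>

context gaussian_noise
begin

text \<open>The limit conditions appear here as explicit inequalities at one \<open>n\<close>. The
  error splits into the exceptional event and the event that the selected rank leaves
  \<open>{a..b}\<close>.\<close>

lemma PI_close_probability:
  fixes S :: "('k, 'p::finite) candidates" and g :: "real ^ 'p \<Rightarrow> real" and sel :: "real vec \<Rightarrow> 'k"
  assumes e: "e > 0" and \<delta>0: "\<delta> > 0" and \<delta>le: "80 * \<delta> \<le> e * \<sigma>\<^sup>2" "80 * \<delta> \<le> e"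
    and \<tau>0: "\<tau> \<le> 1 / 6400" "\<tau> \<le> \<delta> / 4" "\<tau> \<le> e / 40"
    and n: "n \<ge> 2" and l: "l \<ge> inverse (ln (real n))" and d: "d \<ge> 0" and c0: "c0 > 0"
    and ab: "b < n" and a: "a \<ge> 2" "real a \<ge> 40 / e"
    and submodels: "\<And>k. k \<in> cand S n \<Longrightarrow> model_rank S n k > 1 \<Longrightarrow> S1 S n k \<noteq> {}"
    and sel: "\<And>\<omega>. sel (observations S \<epsilon> g n \<omega>) \<in> cand S n"
    and B: "(SUP j \<in> {a..b}. B S g \<sigma> l d n j / ereal (real n - real j)) < ereal (10 * \<tau>)"
    and z: "z \<le> \<delta> / 4"
    and NL: "\<And>j. j \<in> {a..b} \<Longrightarrow>
       num_models S n j * max_submodels S n j \<le> ereal c0 * exp_ereal (ereal z * B S g \<sigma> l d n j)"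
    and N: "\<And>j. j \<in> {a..b} \<Longrightarrow>
       num_models S n j \<le> ereal c0 * exp_ereal ((B S g \<sigma> l d n j)\<^sup>2 / ereal (10 * (real n - real j)))"
    and sum: "(\<Sum>j = a..b. exp_ereal (- ((B S g \<sigma> l d n j)\<^sup>2 / ereal (10 * (real n - real j))))) < ereal \<kappa>"
    and \<kappa>: "\<kappa> \<le> exp (- 1)"
    and bias: "(SUP k \<in> {k \<in> cand S n. a \<le> model_rank S n k \<and> model_rank S n k \<le> b}.
            (INF k' \<in> S1 S n k. ereal (sq_length ((proj_mat S n k - proj_mat S n k') *\<^sub>v signal S g n)))
            / ereal (complexity S g \<sigma> l d n k)) < ereal \<delta>"
    and p: "p = measure M {\<omega> \<in> space M.
            a \<le> model_rank S n (sel (observations S \<epsilon> g n \<omega>)) \<and>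
            model_rank S n (sel (observations S \<epsilon> g n \<omega>)) \<le> b}" "p > 0"
  shows "measure M {\<omega> \<in> space M.
      \<bar>PI S \<sigma> l d n (observations S \<epsilon> g n \<omega>) (sel (observations S \<epsilon> g n \<omega>)) - 1\<bar> > e} \<le> 4 * c0 * \<kappa> + (1 - p)"
    (is "measure M ?X \<le> _")
proof -
  let ?y = "observations S \<epsilon> g n" and ?f = "signal S g n"
  let ?c = "complexity S g \<sigma> l d n"
  note cb = complexity_bounds[OF n l d sigma]
  define \<beta> where "\<beta> j = real_of_ereal (B S g \<sigma> l d n j)" for j
  have "B S g \<sigma> l d n j = ereal (\<beta> j) \<and> 0 \<le> \<beta> j \<and> \<beta> j / (10 * (real n - real j)) \<le> \<tau> \<and>
    finite (models_of_rank S n j) \<and>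
    real (card (models_of_rank S n j)) \<le> c0 * exp ((\<beta> j)\<^sup>2 / (10 * (real n - real j))) \<and>
    (\<forall>k \<in> models_of_rank S n j. finite (S1 S n k)) \<and>
    (\<Sum>k\<in>models_of_rank S n j. real (card (S1 S n k))) \<le> c0 * exp (z * \<beta> j) \<and>
    (\<forall>k \<in> models_of_rank S n j. \<beta> j \<le> complexity S g \<sigma> l d n k)" if j: "j \<in> {a..b}" for j
  proof -
    have B': "B S g \<sigma> l d n j / ereal (real n - real j) < ereal (10 * \<tau>)"
      using SUP_upper[OF j, of "\<lambda>j. B S g \<sigma> l d n j / ereal (real n - real j)"] B by (rule le_less_trans)
    have "j < n" using j ab by simp
    then obtain \<beta>' where \<beta>': "B S g \<sigma> l d n j = ereal \<beta>'" "0 \<le> \<beta>'" "\<beta>' / (10 * (real n - real j)) \<le> \<tau>"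
      "finite (models_of_rank S n j)"
      "real (card (models_of_rank S n j)) \<le> c0 * exp (\<beta>'\<^sup>2 / (10 * (real n - real j)))"
      "\<And>k. k \<in> models_of_rank S n j \<Longrightarrow> finite (S1 S n k)"
      "(\<Sum>k\<in>models_of_rank S n j. real (card (S1 S n k))) \<le> c0 * exp (z * \<beta>')"
      "\<And>k. k \<in> models_of_rank S n j \<Longrightarrow> \<beta>' \<le> complexity S g \<sigma> l d n k"
      by (rule finite_model_data[OF n l d sigma _ B' NL[OF j] N[OF j]]) (rule that)
    have "\<beta> j = \<beta>'" by (simp add: \<beta>_def \<beta>'(1))
    then show ?thesis using \<beta>' by blast
  qed
  then have \<beta>: "B S g \<sigma> l d n j = ereal (\<beta> j)" "0 \<le> \<beta> j" "\<beta> j / (10 * (real n - real j)) \<le> \<tau>"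
    "finite (models_of_rank S n j)"
    "real (card (models_of_rank S n j)) \<le> c0 * exp ((\<beta> j)\<^sup>2 / (10 * (real n - real j)))"
    "(\<Sum>k\<in>models_of_rank S n j. real (card (S1 S n k))) \<le> c0 * exp (z * \<beta> j)"
    and \<beta>k: "k \<in> models_of_rank S n j \<Longrightarrow> finite (S1 S n k)"
      "k \<in> models_of_rank S n j \<Longrightarrow> \<beta> j \<le> complexity S g \<sigma> l d n k"
    if "j \<in> {a..b}" for j k
    using that by blast+
  have jn: "j < n" if "j \<in> {a..b}" for j using that ab by simp
  have S: "(\<Sum>j = a..b. exp (- ((\<beta> j)\<^sup>2 / (10 * (real n - real j))))) < \<kappa>"
  proof -
    have "exp_ereal (- ((B S g \<sigma> l d n j)\<^sup>2 / ereal (10 * (real n - real j))))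
        = ereal (exp (- ((\<beta> j)\<^sup>2 / (10 * (real n - real j)))))" if "j \<in> {a..b}" for j
      using jn[OF that] unfolding \<beta>(1)[OF that] by (simp add: exp_ereal_def power2_eq_square)
    then have "ereal (\<Sum>j = a..b. exp (- ((\<beta> j)\<^sup>2 / (10 * (real n - real j))))) < ereal \<kappa>"
      using sum by (simp flip: sum_ereal)
    then show ?thesis by simp
  qed
  \<comment> \<open>A single summand below \<open>exp (- 1)\<close> gives \<open>1 \<le> ?x\<close>,
    while \<open>?x\<close> is at most \<open>e / 40 * \<beta> j\<close>.\<close>
  have \<beta>large: "40 / e \<le> \<beta> j" if j: "j \<in> {a..b}" for j
  proof -
    let ?x = "(\<beta> j)\<^sup>2 / (10 * (real n - real j))"
    have "exp (- ?x) \<le> (\<Sum>j = a..b. exp (- ((\<beta> j)\<^sup>2 / (10 * (real n - real j)))))"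
      by (rule member_le_sum[OF j, where f = "\<lambda>j. exp (- ((\<beta> j)\<^sup>2 / (10 * (real n - real j))))"]) auto
    then have "exp (- ?x) < exp (- 1)" using S \<kappa> by linarith
    then have "1 \<le> ?x" by simp
    also have "?x = \<beta> j / (10 * (real n - real j)) * \<beta> j" by (simp add: power2_eq_square)
    also have "\<dots> \<le> e / 40 * \<beta> j"
      using \<beta>(2,3)[OF j] \<tau>0(3) by (intro mult_right_mono) linarith+
    finally show ?thesis using e by (simp add: field_simps)
  qed
  obtain E where E: "E \<in> sets M"
    and mE: "measure M E \<le> 4 * c0 * (\<Sum>j = a..b. exp (- ((\<beta> j)\<^sup>2 / (10 * (real n - real j)))))"
    and IC: "\<And>\<omega> k. \<omega> \<in> space M - E \<Longrightarrow> model_rank S n k \<in> {a..b} \<Longrightarrow> k \<in> cand S n \<Longrightarrow>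
          \<sigma>\<^sup>2 * ?c k / 20 \<le> IC S \<sigma> l d n (?y \<omega>) k"
    and noise: "\<And>\<omega> k k'. \<omega> \<in> space M - E \<Longrightarrow> model_rank S n k \<in> {a..b} \<Longrightarrow> k \<in> cand S n \<Longrightarrow> k' \<in> S1 S n k \<Longrightarrow>
          sq_length ((proj_mat S n k - proj_mat S n k') *\<^sub>v noise n \<omega>) \<le> \<delta> * \<sigma>\<^sup>2 * ?c k"
    by (rule exceptional_event[where J = "{a..b}" and S = S and n = n and g = g and l = l and d = d and \<beta> = \<beta>
          and \<delta> = \<delta> and \<tau> = \<tau> and z = z])
       (rule finite_atLeastAtMost jn \<beta> \<beta>k cb(4) \<tau>0 z \<delta>0 c0 | assumption | blast)+
  define R where "R = {\<omega> \<in> space M. a \<le> model_rank S n (sel (?y \<omega>)) \<and> model_rank S n (sel (?y \<omega>)) \<le> b}"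
  have pR: "p = measure M R" by (simp add: R_def p(1))
  \<comment> \<open>A non-measurable set has measure 0, so \<open>p > 0\<close> already yields
    measurability.\<close>
  have R: "R \<in> sets M"
    using p(2) measure_notin_sets[of R M] unfolding pR by auto
  have close: "\<bar>PI S \<sigma> l d n (?y \<omega>) (sel (?y \<omega>)) - 1\<bar> \<le> e" if \<omega>: "\<omega> \<in> R - E" for \<omega>
  proof -
    let ?k = "sel (?y \<omega>)"
    let ?j = "model_rank S n ?k"
    have j: "?j \<in> {a..b}" and k: "?k \<in> cand S n" and \<omega>': "\<omega> \<in> space M - E"
      using \<omega> sel by (auto simp: R_def)
    have kj: "?k \<in> models_of_rank S n ?j" using k by (simp add: models_of_rank_def)
    have c: "40 / e \<le> ?c ?k" using \<beta>large[OF j] \<beta>k(2)[OF j kj] by linarith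
    have c0: "0 < ?c ?k" using c e by (smt (verit) divide_pos_pos)
    have rank: "?j > 1" and ja: "real ?j \<ge> 40 / e" using j a by auto
    have ne: "S1 S n ?k \<noteq> {}" by (rule submodels[OF k rank])
    have ec: "40 \<le> e * ?c ?k" using c e by (simp add: field_simps)
    \<comment> \<open>Rank at least \<open>40 / e\<close> gives
      \<open>l * ln (real n) - 1 \<le> e * ?c ?k / 40\<close>, and the missing 1 is also at most
      \<open>e * ?c ?k / 40\<close>.\<close>
    have lc: "l * ln (real n) \<le> e * ?c ?k / 20"
    proof -
      have "(l * ln (real n) - 1) * (40 / e) \<le> (l * ln (real n) - 1) * real ?j"
        using ja cb(1) by (intro mult_left_mono) auto
      also have "\<dots> \<le> ?c ?k" by (rule cb(3))
      finally have "l * ln (real n) - 1 \<le> ?c ?k / (40 / e)"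
        using e by (subst pos_le_divide_eq) simp_all
      also have "\<dots> = e * ?c ?k / 40" by simp
      finally show ?thesis using ec by linarith
    qed
    let ?I = "INF k' \<in> S1 S n ?k. ereal (sq_length ((proj_mat S n ?k - proj_mat S n k') *\<^sub>v ?f))"
    have "?I / ereal (?c ?k) < ereal \<delta>"
      by (rule le_less_trans[OF SUP_upper bias]) (use j k in auto)
    then have "?I < ereal (\<delta> * ?c ?k)"
      using c0 by (cases ?I) (auto simp: field_simps)
    \<comment> \<open>The strict bound yields a sub-model even if the infimum is not
      attained.\<close>
    then obtain k' where k': "k' \<in> S1 S n ?k"
      and f: "sq_length ((proj_mat S n ?k - proj_mat S n k') *\<^sub>v ?f) < \<delta> * ?c ?k"
      by (auto simp: INF_less_iff)
    let ?D = "proj_mat S n ?k - proj_mat S n k'"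
    have D: "?D \<in> carrier_mat n n" by (simp add: minus_carrier_mat)
    have fc: "?f \<in> carrier_vec n" by (simp add: signal_def)
    have "?D *\<^sub>v ?y \<omega> = ?D *\<^sub>v (?f + noise n \<omega>)"
      by (rule arg_cong[OF observations_eq])
    also have "\<dots> = ?D *\<^sub>v ?f + ?D *\<^sub>v noise n \<omega>"
      by (rule mult_add_distrib_mat_vec[OF D fc noise_carrier])
    finally have "sq_length (?D *\<^sub>v ?y \<omega>) = sq_length (?D *\<^sub>v ?f + ?D *\<^sub>v noise n \<omega>)"
      by (rule arg_cong)
    also have "\<dots> \<le> 2 * sq_length (?D *\<^sub>v ?f) + 2 * sq_length (?D *\<^sub>v noise n \<omega>)"
      by (rule sq_length_add_le[of _ n]) (use mult_mat_vec_carrier[OF D] fc in auto)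
    also have "\<dots> \<le> 2 * (\<delta> * ?c ?k) + 2 * (\<delta> * \<sigma>\<^sup>2 * ?c ?k)"
      using f noise[OF \<omega>' j k k'] by linarith
    \<comment> \<open>Signal and noise each contribute at most
      \<open>e * \<sigma>\<^sup>2 * ?c ?k / 40\<close>. The signal bound carries no factor
      \<open>\<sigma>\<^sup>2\<close>, hence the two conditions on \<open>\<delta>\<close>.\<close>
    also have "\<dots> \<le> e * \<sigma>\<^sup>2 * ?c ?k / 20"
    proof -
      have "80 * \<delta> * ?c ?k \<le> e * \<sigma>\<^sup>2 * ?c ?k"
        using \<delta>le(1) c0 by (intro mult_right_mono) auto
      moreover have "80 * \<delta> * (\<sigma>\<^sup>2 * ?c ?k) \<le> e * (\<sigma>\<^sup>2 * ?c ?k)"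
        using \<delta>le(2) c0 by (intro mult_right_mono) auto
      ultimately show ?thesis unfolding mult.assoc by linarith
    qed
    finally have Dy: "sq_length (?D *\<^sub>v ?y \<omega>) \<le> e * \<sigma>\<^sup>2 * ?c ?k / 20" .
    have "?y \<omega> \<in> carrier_vec n" by (simp add: observations_def)
    moreover have "0 \<le> l * ln (real n)" using cb(1) by linarith
    ultimately show ?thesis
      by (intro PI_close_to_1[OF sigma e c0 rank ne _ IC[OF \<omega>' j k] _ lc k' Dy])
  qed
  show ?thesis
  proof (cases "?X \<in> sets M")
    case True
    have "?X \<subseteq> E \<union> (space M - R)"
    proof
      fix \<omega> assume "\<omega> \<in> ?X"
      then have "\<omega> \<in> space M" "e < \<bar>PI S \<sigma> l d n (?y \<omega>) (sel (?y \<omega>)) - 1\<bar>" by simp_all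
      then show "\<omega> \<in> E \<union> (space M - R)" using close[of \<omega>] by (meson DiffI UnCI not_le)
    qed
    then have "measure M ?X \<le> measure M (E \<union> (space M - R))"
      using E R by (intro finite_measure_mono) auto
    also have "\<dots> \<le> measure M E + measure M (space M - R)"
      using E R by (intro measure_Un_le) auto
    also have "measure M (space M - R) = 1 - p"
      unfolding pR by (rule prob_compl[OF R])
    also have "measure M E \<le> 4 * c0 * \<kappa>"
      using mE mult_left_mono[OF less_imp_le[OF S], of "4 * c0"] c0 by linarith
    finally show ?thesis by simp
  next
    case False \<comment> \<open>then the measure is 0, so measurability of the index need not be shown\<close>
    have "0 \<le> (\<Sum>j = a..b. exp (- ((\<beta> j)\<^sup>2 / (10 * (real n - real j)))))" by (intro sum_nonneg) auto
    then have "0 \<le> \<kappa>" using S by linarith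
    moreover have "p \<le> 1" unfolding pR by (rule prob_le_1)
    ultimately show ?thesis
      using False c0 by (simp add: measure_notin_sets)
  qed
qed

end

section \<open>Passage to the limit\<close>

lemma selection_method_cand:
  fixes S :: "('k, 'p::finite) candidates"
  assumes "selection_method S sel" "n \<ge> 1"
  shows "sel n (observations S \<epsilon> g n \<omega>) \<in> cand S n"
proof -
  \<comment> \<open>The points of the product space are extensional functions, hence the
    restriction.\<close>
  let ?y = "restrict (\<lambda>i. g (design S i) + \<epsilon> i \<omega>) {..<n}"
  have "(\<lambda>y. sel n (vec n y)) \<in> Pi\<^sub>M {..<n} (\<lambda>_. borel) \<rightarrow>\<^sub>M count_space (cand S n)"
    using assms by (simp add: selection_method_def)
  moreover have "?y \<in> space (Pi\<^sub>M {..<n} (\<lambda>_. borel))"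
    by (simp add: space_PiM)
  ultimately have "sel n (vec n ?y) \<in> space (count_space (cand S n))"
    by (rule measurable_space)
  then have "sel n (vec n ?y) \<in> cand S n" by simp
  moreover have "vec n ?y = observations S \<epsilon> g n \<omega>"
    by (rule eq_vecI) (auto simp: observations_def)
  ultimately show ?thesis by simp
qed

theorem theorem2:
  fixes M :: "'w measure"
    and \<epsilon> :: "nat \<Rightarrow> 'w \<Rightarrow> real"
    and \<sigma> d c0 :: real
    and S :: "('k, 'p::finite) candidates"
    and f :: "nat \<Rightarrow> real ^ 'p \<Rightarrow> real"
    and lam \<zeta> :: "nat \<Rightarrow> real"
    and sel :: "nat \<Rightarrow> real vec \<Rightarrow> 'k"
    and a b :: "nat \<Rightarrow> nat"
  assumes prob: "prob_space M"
    and sigma: "\<sigma> > 0"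
    and indep: "prob_space.indep_vars M (\<lambda>_. borel) \<epsilon> UNIV"
    and normal: "\<And>i. distributed M lborel (\<epsilon> i) (normal_density 0 \<sigma>)"
    and submodels: "\<And>n k. n \<ge> 1 \<Longrightarrow> k \<in> cand S n \<Longrightarrow> model_rank S n k > 1 \<Longrightarrow> S1 S n k \<noteq> {}"
    and selection: "selection_method S sel"
    and consistent: "potentially_consistent M \<epsilon> S sel"
    and lam: "\<And>n. n \<ge> 2 \<Longrightarrow> lam n \<ge> inverse (ln (real n))"
    and d: "d \<ge> 0"
    and nonparametric: "\<And>n k. n \<ge> 1 \<Longrightarrow> k \<in> cand S n \<Longrightarrow> f n \<notin> family S k"
    and ab: "\<forall>\<^sub>F n in sequentially. 1 \<le> a n \<and> a n < b n \<and> b n < n"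
    and a_lim: "filterlim a at_top sequentially"
    and N1_rank: "(\<lambda>n. measure M {\<omega> \<in> space M.
            a n \<le> model_rank S n (sel n (observations S \<epsilon> (f n) n \<omega>)) \<and>
            model_rank S n (sel n (observations S \<epsilon> (f n) n \<omega>)) \<le> b n}) \<longlonglongrightarrow> 1"
    and N1_B: "(\<lambda>n. SUP j \<in> {a n..b n}. B S (f n) \<sigma> (lam n) d n j / ereal (real n - real j)) \<longlonglongrightarrow> 0"
    and zeta_pos: "\<And>n. \<zeta> n > 0"
    and zeta_lim: "\<zeta> \<longlonglongrightarrow> 0"
    and c0: "c0 > 0"
    and N2_NL: "\<forall>\<^sub>F n in sequentially. \<forall>j \<in> {a n..b n}.
            num_models S n j * max_submodels S n j
              \<le> ereal c0 * exp_ereal (ereal (\<zeta> n) * B S (f n) \<sigma> (lam n) d n j)"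
    and N2_N: "\<forall>\<^sub>F n in sequentially. \<forall>j \<in> {a n..b n}.
            num_models S n j
              \<le> ereal c0 * exp_ereal ((B S (f n) \<sigma> (lam n) d n j)\<^sup>2 / ereal (10 * (real n - real j)))"
    and N2_sum: "limsup (\<lambda>n. \<Sum>j = a n..b n.
            exp_ereal (- ((B S (f n) \<sigma> (lam n) d n j)\<^sup>2 / ereal (10 * (real n - real j))))) = 0"
    and N3: "limsup (\<lambda>n. SUP k \<in> {k \<in> cand S n. a n \<le> model_rank S n k \<and> model_rank S n k \<le> b n}.
            (INF k' \<in> S1 S n k.
               ereal (sq_length ((proj_mat S n k - proj_mat S n k') *\<^sub>v signal S (f n) n)))
            / ereal (complexity S (f n) \<sigma> (lam n) d n k)) = 0"
  shows "tendsto_in_probability M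
           (\<lambda>n \<omega>. PI S \<sigma> (lam n) d n (observations S \<epsilon> (f n) n \<omega>)
              (sel n (observations S \<epsilon> (f n) n \<omega>))) 1"
proof -
  interpret gaussian_noise M \<epsilon> \<sigma>
    using prob sigma indep normal by (simp add: gaussian_noise_def gaussian_noise_axioms_def)
  let ?y = "\<lambda>n. observations S \<epsilon> (f n) n"
  show ?thesis
    unfolding tendsto_in_probability_def
  proof (intro allI impI)
    fix e :: real assume e: "e > 0"
    define \<delta> where "\<delta> = min e (e * \<sigma>\<^sup>2) / 80"
    define \<tau> where "\<tau> = min (min (1 / 6400) (\<delta> / 4)) (e / 40)"
    have e\<sigma>: "e * \<sigma>\<^sup>2 > 0" using e sigma by simp
    have \<delta>: "\<delta> > 0" "80 * \<delta> \<le> e * \<sigma>\<^sup>2" "80 * \<delta> \<le> e"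
      unfolding \<delta>_def using e e\<sigma> by (auto simp: min_def)
    have \<tau>: "\<tau> > 0" "\<tau> \<le> 1 / 6400" "\<tau> \<le> \<delta> / 4" "\<tau> \<le> e / 40"
      unfolding \<tau>_def using e \<delta>(1) by (auto simp: min_def)
    let ?X = "\<lambda>n. {\<omega> \<in> space M. \<bar>PI S \<sigma> (lam n) d n (?y n \<omega>) (sel n (?y n \<omega>)) - 1\<bar> > e}"
    show "(\<lambda>n. measure M (?X n)) \<longlonglongrightarrow> 0"
    proof (rule tendstoI)
      fix r :: real assume r: "r > 0"
      \<comment> \<open>The first entry forces every \<open>B_{j,n}\<close> in range to be large;
        the second keeps the exceptional probability at most \<open>r / 4\<close>.\<close>
      define \<kappa> where "\<kappa> = min (exp (- 1)) (r / (16 * c0))"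
      have \<kappa>: "\<kappa> > 0" "\<kappa> \<le> exp (- 1)" "4 * c0 * \<kappa> \<le> r / 4"
      proof -
        have "4 * c0 * \<kappa> \<le> 4 * c0 * (r / (16 * c0))"
          using c0 by (intro mult_left_mono) (auto simp: \<kappa>_def)
        then show "4 * c0 * \<kappa> \<le> r / 4" using c0 by simp
      qed (use r c0 in \<open>auto simp: \<kappa>_def\<close>)
      \<comment> \<open>The 2 puts the index in its infimum case; \<open>40 / e\<close> makes the
        penalty for one parameter negligible.\<close>
      have ev_a: "\<forall>\<^sub>F n in sequentially. max 2 (nat \<lceil>40 / e\<rceil>) \<le> a n"
        using a_lim unfolding filterlim_at_top by blast
      have ev_B: "\<forall>\<^sub>F n in sequentially.
          (SUP j \<in> {a n..b n}. B S (f n) \<sigma> (lam n) d n j / ereal (real n - real j)) < ereal (10 * \<tau>)"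
        using \<tau>(1) by (intro order_tendstoD(2)[OF N1_B]) simp
      have ev_\<zeta>: "\<forall>\<^sub>F n in sequentially. \<zeta> n < \<delta> / 4"
        using \<delta>(1) by (intro order_tendstoD(2)[OF zeta_lim]) simp
      have ev_sum: "\<forall>\<^sub>F n in sequentially. (\<Sum>j = a n..b n.
          exp_ereal (- ((B S (f n) \<sigma> (lam n) d n j)\<^sup>2 / ereal (10 * (real n - real j))))) < ereal \<kappa>"
        by (rule Limsup_lessD) (unfold N2_sum, use \<kappa>(1) in simp)
      have ev_bias: "\<forall>\<^sub>F n in sequentially.
          (SUP k \<in> {k \<in> cand S n. a n \<le> model_rank S n k \<and> model_rank S n k \<le> b n}.
            (INF k' \<in> S1 S n k.
               ereal (sq_length ((proj_mat S n k - proj_mat S n k') *\<^sub>v signal S (f n) n)))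
            / ereal (complexity S (f n) \<sigma> (lam n) d n k)) < ereal \<delta>"
        by (rule Limsup_lessD) (unfold N3, use \<delta>(1) in simp)
      \<comment> \<open>The 0 supplies \<open>p > 0\<close>, from which measurability of the rank
        event was derived; \<open>1 - r / 2\<close> controls \<open>1 - p\<close>.\<close>
      have ev_rank: "\<forall>\<^sub>F n in sequentially. max 0 (1 - r / 2) < measure M {\<omega> \<in> space M.
            a n \<le> model_rank S n (sel n (?y n \<omega>)) \<and> model_rank S n (sel n (?y n \<omega>)) \<le> b n}"
        using r by (intro order_tendstoD(1)[OF N1_rank]) simp
      show "\<forall>\<^sub>F n in sequentially. dist (measure M (?X n)) 0 < r"
        using ab ev_a ev_B ev_\<zeta> ev_sum ev_bias ev_rank N2_NL N2_N eventually_ge_at_top[of 2]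
      proof eventually_elim
        case (elim n)
        have n: "n \<ge> 2" by fact
        define p where "p = measure M {\<omega> \<in> space M.
            a n \<le> model_rank S n (sel n (?y n \<omega>)) \<and> model_rank S n (sel n (?y n \<omega>)) \<le> b n}"
        have p: "p > 0" "p > 1 - r / 2" using elim(7) by (auto simp: p_def)
        have a: "a n \<ge> 2" "real (a n) \<ge> 40 / e"
          using elim(2) by (auto simp: nat_le_iff ceiling_le_iff)
        have bn: "b n < n" using elim(1) by simp
        have sub: "S1 S n k \<noteq> {}" if "k \<in> cand S n" "model_rank S n k > 1" for k
          using submodels[OF _ that] n by simp
        have sel: "sel n (?y n \<omega>) \<in> cand S n" for \<omega>
          by (rule selection_method_cand[OF selection]) (use n in simp)
        have "measure M (?X n) \<le> 4 * c0 * \<kappa> + (1 - p)"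
          by (rule PI_close_probability[where sel = "sel n", OF e \<delta> \<tau>(2-4) n lam[OF n] d c0 bn a sub sel elim(3)
                less_imp_le[OF elim(4)] bspec[OF elim(8)] bspec[OF elim(9)] elim(5) \<kappa>(2) elim(6) p_def p(1)])
        also have "\<dots> < r" using \<kappa>(3) p(2) r by linarith
        finally show ?case by simp
      qed
    qed
  qed
qed

end
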